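(* For $i=1,2$ let $G_{i}$ be an $r_{i}$-regular graph of order $p_{i}$ with adjacency spectrum $\{r_{i},\lambda_{i_{2}},\ldots,\lambda_{i_{p_{i}}}\}$. Then the distance signless Laplacian spectrum of the subdivision-edge join $G_{1}\oplus G_{2}$ consists of: (1) for $j=2,\ldots,p_1$, writing $\lambda=\lambda_{1_j}$: $-\lambda+\frac{7p_{1}}{2}+\frac{5p_{2}}{2}+\frac{5p_{1}r_{1}}{4}+\frac{3p_{2}r_{2}}{4}-2r_{1}-8\pm\frac{1}{2}\sqrt{\Delta_{1,j}}$, where $\Delta_{1,j}=4\lambda^2-2\lambda p_{1}r_{1}-4\lambda p_{1}-2\lambda p_{2}r_{2}-4\lambda p_{2}+16\lambda r_{1}+16\lambda+\frac{1}{4}p_{1}^2r_{1}^2+p_{1}^2r_{1}+p_{1}^2+\frac{1}{2}p_{1}p_{2}r_{1}r_{2}+p_{1}p_{2}r_{1}+p_{1}p_{2}r_{2}+2p_{1}p_{2}-4p_{1}r_{1}^2-8p_{1}r_{1}+\frac{1}{4}p_{2}^2r_{2}^2+p_{2}^2r_{2}+p_{2}^2-4p_{2}r_{1}r_{2}-8p_{2}r_{1}+16r_{1}^2+16r_{1}$; (2) for $j=2,\ldots,p_2$, writing $\lambda=\lambda_{2_j}$: $-\lambda+\frac{5p_{1}}{2}+\frac{7p_{2}}{2}+\frac{3p_{1}r_{1}}{4}+\frac{5p_{2}r_{2}}{4}-2r_{2}-8\pm\frac{1}{2}\sqrt{\Delta_{2,j}}$, where $\Delta_{2,j}=4\lambda^2-2\lambda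 p_{1}r_{1}-4\lambda p_{1}-2\lambda p_{2}r_{2}-4\lambda p_{2}+16\lambda r_{2}+16\lambda+\frac{1}{4}p_{1}^2r_{1}^2+p_{1}^2r_{1}+p_{1}^2+\frac{1}{2}p_{1}p_{2}r_{1}r_{2}+p_{1}p_{2}r_{1}+p_{1}p_{2}r_{2}+2p_{1}p_{2}-4p_{1}r_{1}r_{2}-8p_{1}r_{2}+\frac{1}{4}p_{2}^2r_{2}^2+p_{2}^2r_{2}+p_{2}^2-4p_{2}r_{2}^2-8p_{2}r_{2}+16r_{2}^2+16r_{2}$; (3) $3p_{1}+p_{1}r_{1}+2p_{2}+\frac{1}{2}p_{2}r_{2}-8$ with multiplicity $\frac{1}{2}p_{1}r_{1}-p_{1}$; (4) $2p_{1}+\frac{1}{2}p_{1}r_{1}+3p_{2}+p_{2}r_{2}-8$ with multiplicity $\frac{1}{2}p_{2}r_{2}-p_{2}$; (5) the four eigenvalues of the matrix $$\begin{bmatrix} 8p_{1}+\frac{3}{2}p_{1}r_{1}+3p_{2}+p_{2}r_{2}-6r_{1}-8 & \frac{3}{2}p_{1}r_{1}-2r_{1} & 3p_{2} & p_{2}r_{2}\\ 3p_{1}-4 & 3p_{1}+2p_{1}r_{1}+2p_{2}+\frac{1}{2}p_{2}r_{2}-8 & 2p_{2} & \frac{1}{2}p_{2}r_{2}\\ 3p_{1} & p_{1}r_{1} & 3p_{1}+p_{1}r_{1}+8p_{2}+\frac{3}{2}p_{2}r_{2}-6r_{2}-8 & \frac{3}{2}p_{2}r_{2}-2r_{2}\\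 2p_{1} & \frac{1}{2}p_{1}r_{1} & 3p_{2}-4 & 2p_{1}+\frac{1}{2}p_{1}r_{1}+3p_{2}+2p_{2}r_{2}-8\end{bmatrix}.$$
   Context: The subdivision graph $S(G)$ is obtained from $G$ by inserting a new vertex into every edge; $I(G)$ denotes the set of these new vertices. The subdivision-edge join $G_1\oplus G_2$ is obtained from $S(G_1)$ and $S(G_2)$ by joining each vertex of $I(G_1)$ with every vertex of $I(G_2)$. For a connected graph, $\mathcal{D}$ is its distance matrix, $Tr$ the diagonal matrix of vertex transmissions ($Tr(u)=\sum_v d(u,v)$), and the distance signless Laplacian matrix is $\mathcal{Q}=Tr+\mathcal{D}$. *)

theory Defs
  imports
    Complex_Main
    "HOL-Library.Multiset"
    "HOL-Computational_Algebra.Polynomial"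
    "Graph_Theory.Graph_Theory"
    "Jordan_Normal_Form.Char_Poly"
begin

text \<open>A finite simple graph is a \<open>pair_graph\<close>: a finite, loop-free, symmetric digraph
  without parallel arcs. An undirected edge is the set of its two end vertices.\<close>

definition edge_set :: "'a pair_pre_digraph \<Rightarrow> 'a set set" where
  "edge_set G = {{u, v} | u v. (u, v) \<in> parcs G}"

definition regular_graph :: "'a pair_pre_digraph \<Rightarrow> nat \<Rightarrow> bool" where
  "regular_graph G r \<longleftrightarrow> (\<forall>v \<in> pverts G. out_degree (with_proj G) v = r)"

text \<open>In the subdivision graph, \<open>Inl u\<close> is the original vertex \<open>u\<close> and \<open>Inr e\<close> is the
  new vertex inserted into the edge \<open>e\<close>.\<close>

definition inserted_verts :: "'a pair_pre_digraph \<Rightarrow> ('a + 'a set) set" where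
  "inserted_verts G = Inr ` edge_set G"

definition subdivision_graph :: "'a pair_pre_digraph \<Rightarrow> ('a + 'a set) pair_pre_digraph" where
  "subdivision_graph G =
    \<lparr> pverts = Inl ` pverts G \<union> inserted_verts G,
      parcs = {(Inl u, Inr e) | u e. e \<in> edge_set G \<and> u \<in> e} \<union>
              {(Inr e, Inl u) | u e. e \<in> edge_set G \<and> u \<in> e} \<rparr>"

definition subdivision_edge_join ::
    "'a pair_pre_digraph \<Rightarrow> 'b pair_pre_digraph \<Rightarrow> (('a + 'a set) + ('b + 'b set)) pair_pre_digraph" where
  "subdivision_edge_join G1 G2 =
    \<lparr> pverts = Inl ` pverts (subdivision_graph G1) \<union> Inr ` pverts (subdivision_graph G2),
      parcs = {(Inl x, Inl y) | x y. (x, y) \<in> parcs (subdivision_graph G1)} \<union>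
              {(Inr x, Inr y) | x y. (x, y) \<in> parcs (subdivision_graph G2)} \<union>
              {(Inl x, Inr y) | x y. x \<in> inserted_verts G1 \<and> y \<in> inserted_verts G2} \<union>
              {(Inr y, Inl x) | x y. x \<in> inserted_verts G1 \<and> y \<in> inserted_verts G2} \<rparr>"

text \<open>\<open>wf_digraph.\<mu>\<close> is the infimum of the costs of all walks; with unit arc costs it is
  the usual graph distance. The distance is only meaningful between vertices joined by a walk.\<close>

definition graph_dist :: "'a pair_pre_digraph \<Rightarrow> 'a \<Rightarrow> 'a \<Rightarrow> real" where
  "graph_dist G u v = real_of_ereal (wf_digraph.\<mu> (with_proj G) (\<lambda>_. 1) u v)"

definition transmission :: "'a pair_pre_digraph \<Rightarrow> 'a \<Rightarrow> real" where
  "transmission G u = (\<Sum>v \<in> pverts G. graph_dist G u v)"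

text \<open>The matrices of a graph are written down with respect to a listing \<open>vs\<close> of its
  vertices; their spectra do not depend on the listing.\<close>

definition vertex_listing :: "'a list \<Rightarrow> 'a pair_pre_digraph \<Rightarrow> bool" where
  "vertex_listing vs G \<longleftrightarrow> distinct vs \<and> set vs = pverts G"

definition adjacency_matrix :: "'a list \<Rightarrow> 'a pair_pre_digraph \<Rightarrow> real mat" where
  "adjacency_matrix vs G =
    mat (length vs) (length vs) (\<lambda>(i, j). if (vs ! i, vs ! j) \<in> parcs G then 1 else 0)"

definition distance_matrix :: "'a list \<Rightarrow> 'a pair_pre_digraph \<Rightarrow> real mat" where
  "distance_matrix vs G =
    mat (length vs) (length vs) (\<lambda>(i, j). graph_dist G (vs ! i) (vs ! j))"

definition transmission_matrix :: "'a list \<Rightarrow> 'a pair_pre_digraph \<Rightarrow> real mat" where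
  "transmission_matrix vs G = mat_diag (length vs) (\<lambda>i. transmission G (vs ! i))"

definition distance_signless_laplacian :: "'a list \<Rightarrow> 'a pair_pre_digraph \<Rightarrow> real mat" where
  "distance_signless_laplacian vs G = transmission_matrix vs G + distance_matrix vs G"

text \<open>The eigenvalues with their algebraic multiplicities. They are taken in the complex
  numbers, so that an \<open>n \<times> n\<close> matrix always has exactly \<open>n\<close> of them.\<close>

definition spectrum_mset :: "real mat \<Rightarrow> complex multiset" where
  "spectrum_mset A = proots (char_poly (map_mat complex_of_real A))"

definition Delta1 :: "real \<Rightarrow> real \<Rightarrow> real \<Rightarrow> real \<Rightarrow> real \<Rightarrow> real" where
  "Delta1 p1 r1 p2 r2 lam =
     4 * lam^2 - 2 * lam * p1 * r1 - 4 * lam * p1 - 2 * lam * p2 * r2 - 4 * lam * p2 + 16 * lam * r1 + 16 * lam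
     + 1/4 * p1^2 * r1^2 + p1^2 * r1 + p1^2 + 1/2 * p1 * p2 * r1 * r2 + p1 * p2 * r1 + p1 * p2 * r2
     + 2 * p1 * p2 - 4 * p1 * r1^2 - 8 * p1 * r1 + 1/4 * p2^2 * r2^2 + p2^2 * r2 + p2^2
     - 4 * p2 * r1 * r2 - 8 * p2 * r1 + 16 * r1^2 + 16 * r1"

definition Delta2 :: "real \<Rightarrow> real \<Rightarrow> real \<Rightarrow> real \<Rightarrow> real \<Rightarrow> real" where
  "Delta2 p1 r1 p2 r2 lam =
     4 * lam^2 - 2 * lam * p1 * r1 - 4 * lam * p1 - 2 * lam * p2 * r2 - 4 * lam * p2 + 16 * lam * r2 + 16 * lam
     + 1/4 * p1^2 * r1^2 + p1^2 * r1 + p1^2 + 1/2 * p1 * p2 * r1 * r2 + p1 * p2 * r1 + p1 * p2 * r2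
     + 2 * p1 * p2 - 4 * p1 * r1 * r2 - 8 * p1 * r2 + 1/4 * p2^2 * r2^2 + p2^2 * r2 + p2^2
     - 4 * p2 * r2^2 - 8 * p2 * r2 + 16 * r2^2 + 16 * r2"

definition center1 :: "real \<Rightarrow> real \<Rightarrow> real \<Rightarrow> real \<Rightarrow> real \<Rightarrow> real" where
  "center1 p1 r1 p2 r2 lam =
     - lam + 7 * p1 / 2 + 5 * p2 / 2 + 5 * p1 * r1 / 4 + 3 * p2 * r2 / 4 - 2 * r1 - 8"

definition center2 :: "real \<Rightarrow> real \<Rightarrow> real \<Rightarrow> real \<Rightarrow> real \<Rightarrow> real" where
  "center2 p1 r1 p2 r2 lam =
     - lam + 5 * p1 / 2 + 7 * p2 / 2 + 3 * p1 * r1 / 4 + 5 * p2 * r2 / 4 - 2 * r2 - 8"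

definition plus_minus :: "real \<Rightarrow> real \<Rightarrow> real multiset" where
  "plus_minus c d = {# c + d, c - d #}"

definition edge_value1 :: "real \<Rightarrow> real \<Rightarrow> real \<Rightarrow> real \<Rightarrow> real" where
  "edge_value1 p1 r1 p2 r2 = 3 * p1 + p1 * r1 + 2 * p2 + 1/2 * p2 * r2 - 8"

definition edge_value2 :: "real \<Rightarrow> real \<Rightarrow> real \<Rightarrow> real \<Rightarrow> real" where
  "edge_value2 p1 r1 p2 r2 = 2 * p1 + 1/2 * p1 * r1 + 3 * p2 + p2 * r2 - 8"

definition quotient_matrix :: "real \<Rightarrow> real \<Rightarrow> real \<Rightarrow> real \<Rightarrow> real mat" where
  "quotient_matrix p1 r1 p2 r2 = mat_of_rows_list 4
    [[8 * p1 + 3/2 * p1 * r1 + 3 * p2 + p2 * r2 - 6 * r1 - 8,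
      3/2 * p1 * r1 - 2 * r1,
      3 * p2,
      p2 * r2],
     [3 * p1 - 4,
      3 * p1 + 2 * p1 * r1 + 2 * p2 + 1/2 * p2 * r2 - 8,
      2 * p2,
      1/2 * p2 * r2],
     [3 * p1,
      p1 * r1,
      3 * p1 + p1 * r1 + 8 * p2 + 3/2 * p2 * r2 - 6 * r2 - 8,
      3/2 * p2 * r2 - 2 * r2],
     [2 * p1,
      1/2 * p1 * r1,
      3 * p2 - 4,
      2 * p1 + 1/2 * p1 * r1 + 3 * p2 + 2 * p2 * r2 - 8]]"

end

theory Submission
  imports Defs
begin

text \<open>
  Between the four classes of vertices of the join (original and inserted vertices on either side) the
  distance depends only on the classes, up to corrections that stay inside one side. Hence the distance
  signless Laplacian is \<open>D + U W\<close>, where \<open>U\<close> is the indicator matrix of the four classes and \<open>D\<close> is block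
  diagonal with one block \<open>[[a I - 2 A, - 2 B], [- 2 B\<^sup>T, b I]]\<close> for each side, \<open>A\<close> being the adjacency and
  \<open>B\<close> the incidence matrix. By regularity the classes are equitable for \<open>D\<close>, that is \<open>D U = U E\<close> for a
  \<open>4 \<times> 4\<close> matrix \<open>E\<close>, and the characteristic polynomials satisfy
  \<open>\<chi>(D + U W) \<chi>(E) = \<chi>(D) \<chi>(E + W U)\<close>, where \<open>E + W U\<close> is the quotient matrix. From \<open>B B\<^sup>T = A + r I\<close>
  one finds that \<open>\<chi>\<close> of a block of \<open>D\<close> is \<open>(x - b)\<^bsup>m - p\<^esup>\<close> times the product over the eigenvalues \<open>\<lambda>\<close> of \<open>A\<close> of
  \<open>(x - b) (x - a + 2 \<lambda>) - 4 (\<lambda> + r)\<close>. The factors with \<open>\<lambda> = r\<close> make up \<open>\<chi>(E)\<close> and cancel, and the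
  others split over the reals because \<open>\<lambda> \<ge> - r\<close>.
\<close>

section \<open>Matrices indexed by lists\<close>

text \<open>Rows and columns are addressed by elements instead of positions, so that matrix products
  become sums over sets of vertices and edges.\<close>

definition list_mat :: "'a list \<Rightarrow> 'b list \<Rightarrow> ('a \<Rightarrow> 'b \<Rightarrow> 'c) \<Rightarrow> 'c mat" where
  "list_mat xs ys f = mat (length xs) (length ys) (\<lambda>(i, j). f (xs ! i) (ys ! j))"

lemma list_mat_carrier [simp]: "list_mat xs ys f \<in> carrier_mat (length xs) (length ys)"
  by (simp add: list_mat_def)

lemma dim_list_mat [simp]:
  "dim_row (list_mat xs ys f) = length xs" "dim_col (list_mat xs ys f) = length ys"
  by (simp_all add: list_mat_def)

lemma index_list_mat [simp]:
  "i < length xs \<Longrightarrow> j < length ys \<Longrightarrow> list_mat xs ys f $$ (i, j) = f (xs ! i) (ys ! j)"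
  by (simp add: list_mat_def)

lemma list_mat_cong:
  assumes "\<And>x y. x \<in> set xs \<Longrightarrow> y \<in> set ys \<Longrightarrow> f x y = g x y"
  shows "list_mat xs ys f = list_mat xs ys g"
  by (rule eq_matI) (auto simp: assms)

lemma list_mat_append:
  "list_mat (xs @ xs') (ys @ ys') f =
     four_block_mat (list_mat xs ys f) (list_mat xs ys' f) (list_mat xs' ys f) (list_mat xs' ys' f)"
  by (rule eq_matI) (auto simp: nth_append)

lemma list_mat_map: "list_mat (map h xs) (map k ys) f = list_mat xs ys (\<lambda>x y. f (h x) (k y))"
  by (rule eq_matI) auto

lemma list_mat_const_zero: "list_mat xs ys (\<lambda>_ _. 0) = 0\<^sub>m (length xs) (length ys)"
  by (rule eq_matI) auto

lemma list_mat_add: "list_mat xs ys f + list_mat xs ys g = list_mat xs ys (\<lambda>x y. f x y + g x y)"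
  by (rule eq_matI) auto

lemma list_mat_mult:
  fixes f :: "'a \<Rightarrow> 'b \<Rightarrow> 'c :: comm_semiring_1"
  assumes "distinct ys"
  shows "list_mat xs ys f * list_mat ys zs g = list_mat xs zs (\<lambda>x z. \<Sum>y\<in>set ys. f x y * g y z)"
proof (rule eq_matI)
  fix i j assume ij: "i < dim_row (list_mat xs zs (\<lambda>x z. \<Sum>y\<in>set ys. f x y * g y z))"
    "j < dim_col (list_mat xs zs (\<lambda>x z. \<Sum>y\<in>set ys. f x y * g y z))"
  have "(\<Sum>y\<in>set ys. f (xs ! i) y * g y (zs ! j)) =
        (\<Sum>k = 0..<length ys. f (xs ! i) (ys ! k) * g (ys ! k) (zs ! j))"
    using assms
    by (intro sum.reindex_bij_betw[symmetric] bij_betw_nth) (auto simp: atLeast0LessThan)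
  then show "(list_mat xs ys f * list_mat ys zs g) $$ (i, j) =
      list_mat xs zs (\<lambda>x z. \<Sum>y\<in>set ys. f x y * g y z) $$ (i, j)"
    using ij by (simp add: scalar_prod_def)
qed auto

lemma list_mat_of_bool_eq:
  "distinct xs \<Longrightarrow> list_mat xs xs (\<lambda>x y. of_bool (x = y)) = 1\<^sub>m (length xs)"
  by (rule eq_matI) (auto simp: nth_eq_iff_index_eq)

lemma sum_of_bool_mult:
  fixes g :: "'a \<Rightarrow> 'c :: comm_semiring_1"
  assumes "finite S" "x \<in> S"
  shows "(\<Sum>y\<in>S. of_bool (x = y) * g y) = g x" "(\<Sum>y\<in>S. g y * of_bool (y = x)) = g x"
proof -
  have "(\<Sum>y\<in>S. of_bool (x = y) * g y) = (\<Sum>y\<in>S. if x = y then g y else 0)"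
    by (rule sum.cong) auto
  then show "(\<Sum>y\<in>S. of_bool (x = y) * g y) = g x"
    using assms by simp
  have "(\<Sum>y\<in>S. g y * of_bool (y = x)) = (\<Sum>y\<in>S. if y = x then g y else 0)"
    by (rule sum.cong) auto
  then show "(\<Sum>y\<in>S. g y * of_bool (y = x)) = g x"
    using assms by simp
qed

text \<open>The 0/1 matrices \<open>?P\<close> and \<open>?Q\<close> that match equal elements of
  the two listings are mutually inverse permutation matrices. This allows the vertices of the join
  to be ordered by class later.\<close>

lemma char_poly_list_mat_listing:
  fixes f :: "'a \<Rightarrow> 'a \<Rightarrow> 'c :: comm_ring_1"
  assumes "distinct xs" "distinct ys" "set xs = set ys"
  shows "char_poly (list_mat xs xs f) = char_poly (list_mat ys ys f)"
proof (rule char_poly_similar, rule similar_matI)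
  let ?P = "list_mat xs ys (\<lambda>x y. of_bool (x = y)) :: 'c mat" and ?Q = "list_mat ys xs (\<lambda>x y. of_bool (x = y)) :: 'c mat"
  have len: "length xs = length ys"
    using assms by (metis distinct_card)
  show "{list_mat xs xs f, list_mat ys ys f, ?P, ?Q} \<subseteq> carrier_mat (length xs) (length xs)"
    by (simp add: carrier_matI len)
  have "?P * ?Q = list_mat xs xs (\<lambda>x y. of_bool (x = y))"
    unfolding list_mat_mult[OF assms(2)]
    by (rule list_mat_cong) (simp add: sum_of_bool_mult assms(3))
  then show "?P * ?Q = 1\<^sub>m (length xs)"
    by (simp add: list_mat_of_bool_eq assms)
  have "?Q * ?P = list_mat ys ys (\<lambda>x y. of_bool (x = y))"
    unfolding list_mat_mult[OF assms(1)]
    by (rule list_mat_cong) (simp add: sum_of_bool_mult assms(3)[symmetric])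
  then show "?Q * ?P = 1\<^sub>m (length xs)"
    by (simp add: list_mat_of_bool_eq assms len)
  show "list_mat xs xs f = ?P * list_mat ys ys f * ?Q"
    unfolding list_mat_mult[OF assms(2)]
    by (rule list_mat_cong) (simp add: sum_of_bool_mult assms(3))
qed

section \<open>Block matrices, equitable partitions and affine combinations\<close>

lemma char_poly_block_upper_right_zero:
  fixes A :: "'a :: idom mat"
  assumes "A \<in> carrier_mat n n" "C \<in> carrier_mat m n" "D \<in> carrier_mat m m"
  shows "char_poly (four_block_mat A (0\<^sub>m n m) C D) = char_poly A * char_poly D"
proof -
  have "char_poly_matrix (four_block_mat A (0\<^sub>m n m) C D) =
     four_block_mat (char_poly_matrix A) (0\<^sub>m n m) (map_mat (\<lambda>a. [:- a:]) C) (char_poly_matrix D)"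
    by (rule eq_matI) (use assms in \<open>auto simp: char_poly_matrix_def\<close>)
  then show ?thesis
    unfolding char_poly_def using assms
    by (simp add: det_four_block_mat_upper_right_zero[of _ n _ m])
qed

text \<open>Both sides are characteristic polynomials of block triangular matrices that are conjugate by the
  unipotent block matrix with upper right block \<open>U\<close>; no inverse of \<open>x I - D\<close> is needed.\<close>

lemma char_poly_mult_of_intertwining:
  fixes D :: "'a :: idom mat"
  assumes D: "D \<in> carrier_mat n n" and U: "U \<in> carrier_mat n k"
    and W: "W \<in> carrier_mat k n" and E: "E \<in> carrier_mat k k" and DU: "D * U = U * E"
  shows "char_poly (D + U * W) * char_poly E = char_poly D * char_poly (E + W * U)"
proof -
  let ?X = "four_block_mat (D + U * W) (0\<^sub>m n k) W E"
  let ?Y = "four_block_mat D (0\<^sub>m n k) W (E + W * U)"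
  let ?P = "four_block_mat (1\<^sub>m n) U (0\<^sub>m k n) (1\<^sub>m k)"
  let ?Q = "four_block_mat (1\<^sub>m n) (- U) (0\<^sub>m k n) (1\<^sub>m k)"
  have UW: "U * W \<in> carrier_mat n n" and WU: "W * U \<in> carrier_mat k k"
    and UE: "U * E \<in> carrier_mat n k"
    using U W E by auto
  have "U + - U = 0\<^sub>m n k" "- 0\<^sub>m k k + 1\<^sub>m k = (1\<^sub>m k :: 'a mat)"
    using U by (auto intro!: eq_matI)
  then have PQ: "?P * ?Q = 1\<^sub>m (n + k)" and QP: "?Q * ?P = 1\<^sub>m (n + k)"
    using U by (simp_all add: mult_four_block_mat[of _ n n _ k _ k _ _ n _ k] uminus_l_inv_mat)
  have PY: "?P * ?Y = four_block_mat (D + U * W) (U * (E + W * U)) W (E + W * U)"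
    using D U W E by (simp add: mult_four_block_mat[of _ n n _ k _ k _ _ n _ k])
  \<comment> \<open>Here \<open>DU\<close> enters; it makes the upper right block of
    \<open>?P * ?Y * ?Q\<close> vanish.\<close>
  have UEWU: "U * (E + W * U) = (D + U * W) * U"
    using D U W E UW WU by (simp add: mult_add_distrib_mat[of _ n k] add_mult_distrib_mat[of _ n n] DU)
  have "(D + U * W) * (- U) = - ((D + U * W) * U)"
    using D U W by (intro uminus_mult_right_mat) auto
  moreover have "(D + U * W) * U \<in> carrier_mat n k"
    by (rule mult_carrier_mat[OF add_carrier_mat[OF UW] U])
  ultimately have 1: "(D + U * W) * (- U) + U * (E + W * U) = 0\<^sub>m n k"
    unfolding UEWU by (simp only: uminus_l_inv_mat)
  have 2: "W * (- U) + (E + W * U) = E"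
    using W U E WU by (intro eq_matI) auto
  have "?P * ?Y * ?Q = ?X"
    unfolding PY using D U W E 1 2
    by (simp add: mult_four_block_mat[of _ n n _ k _ k _ _ n _ k])
  then have "similar_mat ?X ?Y"
    using PQ QP D U W E by (intro similar_matI[of _ _ ?P ?Q "n + k"]) auto
  from char_poly_similar[OF this] show ?thesis
    using D U W E by (simp add: char_poly_block_upper_right_zero[of _ n _ k])
qed

text \<open>A term depending only on the classes factors as \<open>?U * ?W\<close> through the class
  indicators \<open>?U\<close>, and constant row sums of \<open>d\<close> over each class say
  exactly \<open>?D * ?U = ?U * ?E\<close>.\<close>

lemma char_poly_equitable_partition:
  fixes d :: "'a \<Rightarrow> 'a \<Rightarrow> 'c :: idom" and cl :: "'a \<Rightarrow> 'k"
  assumes "distinct xs" and "distinct ks" and cl: "\<And>x. x \<in> set xs \<Longrightarrow> cl x \<in> set ks"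
    and eq: "\<And>x l. x \<in> set xs \<Longrightarrow> l \<in> set ks \<Longrightarrow>
            (\<Sum>y\<in>set xs. if cl y = l then d x y else 0) = e (cl x) l"
  shows "char_poly (list_mat xs xs (\<lambda>x y. d x y + c (cl x) (cl y))) * char_poly (list_mat ks ks e) =
         char_poly (list_mat xs xs d) *
         char_poly (list_mat ks ks (\<lambda>k l. e k l + (\<Sum>y\<in>set xs. if cl y = l then c k l else 0)))"
proof -
  let ?D = "list_mat xs xs d" and ?U = "list_mat xs ks (\<lambda>x k. of_bool (cl x = k))"
  let ?W = "list_mat ks xs (\<lambda>k y. c k (cl y))" and ?E = "list_mat ks ks e"
  have "?D * ?U = ?U * ?E"
    unfolding list_mat_mult[OF assms(1)] list_mat_mult[OF assms(2)]
  proof (rule list_mat_cong)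
    fix x k assume x: "x \<in> set xs" and k: "k \<in> set ks"
    have "(\<Sum>y\<in>set xs. d x y * of_bool (cl y = k)) = e (cl x) k"
      unfolding eq[OF x k, symmetric] by (rule sum.cong) auto
    then show "(\<Sum>y\<in>set xs. d x y * of_bool (cl y = k)) = (\<Sum>j\<in>set ks. of_bool (cl x = j) * e j k)"
      by (simp add: sum_of_bool_mult(1) cl x)
  qed
  then have *: "char_poly (?D + ?U * ?W) * char_poly ?E = char_poly ?D * char_poly (?E + ?W * ?U)"
    by (intro char_poly_mult_of_intertwining[OF list_mat_carrier list_mat_carrier list_mat_carrier
      list_mat_carrier])
  have "?U * ?W = list_mat xs xs (\<lambda>x y. c (cl x) (cl y))"
    unfolding list_mat_mult[OF assms(2)]
    by (rule list_mat_cong) (simp add: sum_of_bool_mult cl)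
  then have 1: "?D + ?U * ?W = list_mat xs xs (\<lambda>x y. d x y + c (cl x) (cl y))"
    by (intro eq_matI) auto
  have "?W * ?U = list_mat ks ks (\<lambda>k l. \<Sum>y\<in>set xs. if cl y = l then c k l else 0)"
    unfolding list_mat_mult[OF assms(1)]
    by (intro list_mat_cong sum.cong) auto
  then have 2: "?E + ?W * ?U =
      list_mat ks ks (\<lambda>k l. e k l + (\<Sum>y\<in>set xs. if cl y = l then c k l else 0))"
    by (intro eq_matI) auto
  show ?thesis
    using * unfolding 1 2 .
qed

lemma poly_char_poly_list_mat:
  fixes f :: "'a \<Rightarrow> 'a \<Rightarrow> 'c :: field"
  assumes "distinct xs"
  shows "poly (char_poly (list_mat xs xs f)) t = det (list_mat xs xs (\<lambda>x y. (if x = y then t else 0) - f x y))"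
proof -
  have "- char_matrix (list_mat xs xs f) t = list_mat xs xs (\<lambda>x y. (if x = y then t else 0) - f x y)"
    by (rule eq_matI) (auto simp: char_matrix_def nth_eq_iff_index_eq assms)
  then show ?thesis
    by (simp add: char_poly_matrix[of _ "length xs"])
qed

text \<open>For nonzero \<open>g\<close> the determinant is \<open>(- g) ^ n\<close> times the
  characteristic polynomial at \<open>- f / g\<close>. Comparing degrees in \<open>ch\<close> shows
  that \<open>n\<close> is the number of factors, so the power can be distributed over them.\<close>

lemma det_affine_of_char_poly:
  fixes A :: "'a :: field mat"
  assumes A: "A \<in> carrier_mat n n" and ch: "char_poly A = (\<Prod>l\<in>#L. [:- l, 1:])"
  shows "det (f \<cdot>\<^sub>m 1\<^sub>m n + g \<cdot>\<^sub>m A) = (\<Prod>l\<in>#L. f + g * l)"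
proof -
  have "degree (\<Prod>l\<in>#L. [:- l, 1:]) = size L"
  proof (induction L)
    case (add x L)
    have "(\<Prod>l\<in>#L. [:- l, 1:]) \<noteq> 0"
      by (auto simp: prod_mset_zero_iff)
    then show ?case
      using add by (simp add: degree_mult_eq del: mult_pCons_left)
  qed simp
  then have n: "n = size L"
    using degree_monic_char_poly[OF A] ch by simp
  show ?thesis
  proof (cases "g = 0")
    \<comment> \<open>This case does occur: in the application \<open>g\<close> is
      \<open>2 * y - 4\<close>.\<close>
    case True
    then have "f \<cdot>\<^sub>m 1\<^sub>m n + g \<cdot>\<^sub>m A = f \<cdot>\<^sub>m 1\<^sub>m n"
      using A by (intro eq_matI) auto
    then show ?thesis
      by (simp add: True n)
  next
    case False
    have "f \<cdot>\<^sub>m 1\<^sub>m n + g \<cdot>\<^sub>m A = (- g) \<cdot>\<^sub>m (- char_matrix A (- f / g))"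
      using A False by (intro eq_matI) (auto simp: char_matrix_def field_simps)
    also have "det \<dots> = (- g) ^ n * poly (char_poly A) (- f / g)"
      using A by (simp add: char_poly_matrix[OF A] char_matrix_def)
    also have "\<dots> = (\<Prod>l\<in>#L. (- g) * (- f / g - l))"
      unfolding ch n by (induction L) (simp_all add: algebra_simps)
    also have "\<dots> = (\<Prod>l\<in>#L. f + g * l)"
      using False by (simp add: algebra_simps)
    finally show ?thesis .
  qed
qed

section \<open>Characteristic polynomials and spectra\<close>

lemma det_list_mat_two:
  fixes f :: "'a \<Rightarrow> 'a \<Rightarrow> 'c :: idom"
  shows "det (list_mat [k, l] [k, l] f) = f k k * f l l - f k l * f l k"
proof -
  have "list_mat [k, l] [k, l] f = list_mat ([k] @ [l]) ([k] @ [l]) f"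
    by simp
  also have "\<dots> = four_block_mat (list_mat [k] [k] f) (list_mat [k] [l] f) (list_mat [l] [k] f) (list_mat [l] [l] f)"
    by (rule list_mat_append)
  also have "det \<dots> = det (list_mat [k] [k] f * list_mat [l] [l] f - list_mat [k] [l] f * list_mat [l] [k] f)"
  proof (rule det_four_block_mat[of _ 1])
    show "list_mat [l] [k] f * list_mat [l] [l] f = list_mat [l] [l] f * list_mat [l] [k] f"
      by (rule eq_matI) (auto simp: scalar_prod_def)
  qed (simp_all add: carrier_matI)
  also have "\<dots> = f k k * f l l - f k l * f l k"
    by (subst det_single) (simp_all add: carrier_matI scalar_prod_def)
  finally show ?thesis .
qed

lemma char_poly_list_mat_two:
  fixes f :: "'a \<Rightarrow> 'a \<Rightarrow> real"
  assumes "k \<noteq> l"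
  shows "char_poly (list_mat [k, l] [k, l] f) = [:- f k k, 1:] * [:- f l l, 1:] - [:f k l * f l k:]"
proof (rule poly_ext)
  fix t
  show "poly (char_poly (list_mat [k, l] [k, l] f)) t = poly ([:- f k k, 1:] * [:- f l l, 1:] - [:f k l * f l k:]) t"
    using assms by (simp add: poly_char_poly_list_mat det_list_mat_two algebra_simps)
qed

lemma map_poly_of_real_linear_prod:
  "map_poly complex_of_real (\<Prod>x\<in>#M. [:- x, 1:]) = (\<Prod>x\<in>#image_mset complex_of_real M. [:- x, 1:])"
proof -
  interpret map_poly_inj_idom_hom complex_of_real ..
  show ?thesis
    by (induction M) (simp_all add: hom_distribs del: mult_pCons_left)
qed

lemma proots_linear_prod: "proots (\<Prod>x\<in>#M. [:- x, 1:]) = (M :: 'a :: idom multiset)"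
proof (induction M)
  case (add x M)
  have "(\<Prod>x\<in>#M. [:- x, 1:]) \<noteq> 0"
    by (auto simp: prod_mset_zero_iff)
  then show ?case
    using add by (simp add: proots_mult del: mult_pCons_left)
qed simp

text \<open>Every complex polynomial splits; since the roots are real, the factorization can be
  pulled back along the injective \<open>map_poly complex_of_real\<close>.\<close>

lemma char_poly_of_spectrum_mset:
  assumes A: "A \<in> carrier_mat n n" and spec: "spectrum_mset A = image_mset complex_of_real L"
  shows "char_poly A = (\<Prod>l\<in>#L. [:- l, 1:])"
proof -
  interpret map_poly_inj_idom_hom complex_of_real ..
  have "map_poly complex_of_real (char_poly A) = char_poly (map_mat complex_of_real A)"
    using A by (rule of_real_hom.char_poly_hom[symmetric])
  also have "\<dots> = (\<Prod>l\<in>#proots (char_poly (map_mat complex_of_real A)). [:- l, 1:])"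
    using complex_poly_decompose_multiset[of "char_poly (map_mat complex_of_real A)"]
      degree_monic_char_poly[of "map_mat complex_of_real A" n] A by simp
  also have "\<dots> = map_poly complex_of_real (\<Prod>l\<in>#L. [:- l, 1:])"
    using spec by (simp only: spectrum_mset_def map_poly_of_real_linear_prod)
  finally show ?thesis
    by simp
qed

text \<open>Roots of a product add up as multisets. Linear factors on the left stay there as
  \<open>M\<close>, so that negative differences of multiplicities can be expressed without dividing
  polynomials.\<close>

lemma spectrum_mset_of_char_poly_mult:
  assumes A: "A \<in> carrier_mat n n" and B: "B \<in> carrier_mat m m"
    and eq: "char_poly A * (\<Prod>x\<in>#M. [:- x, 1:]) = (\<Prod>x\<in>#N. [:- x, 1:]) * char_poly B"
  shows "spectrum_mset A + image_mset complex_of_real M = image_mset complex_of_real N + spectrum_mset B"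
proof -
  interpret map_poly_inj_idom_hom complex_of_real ..
  let ?A = "char_poly (map_mat complex_of_real A)" and ?B = "char_poly (map_mat complex_of_real B)"
  let ?M = "\<Prod>x\<in>#image_mset complex_of_real M. [:- x, 1:]"
  let ?N = "\<Prod>x\<in>#image_mset complex_of_real N. [:- x, 1:]"
  have "?A * ?M = ?N * ?B"
    unfolding of_real_hom.char_poly_hom[OF A] of_real_hom.char_poly_hom[OF B]
      map_poly_of_real_linear_prod[symmetric]
    using arg_cong[OF eq, of "map_poly complex_of_real"] by (simp only: hom_mult)
  then have "proots (?A * ?M) = proots (?N * ?B)"
    by simp
  moreover have "?A \<noteq> 0" "?B \<noteq> 0"
    using degree_monic_char_poly[of "map_mat complex_of_real A" n]
      degree_monic_char_poly[of "map_mat complex_of_real B" m] A B by auto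
  moreover have "?M \<noteq> 0" "?N \<noteq> 0"
    by (auto simp: prod_mset_zero_iff)
  ultimately show ?thesis
    by (simp only: spectrum_mset_def proots_mult proots_linear_prod simp_thms)
qed

section \<open>Distances in the subdivision-edge join\<close>

text \<open>A potential certifies distances: by \<open>arc\<close>, \<delta> rises by at most one
  along an arc, so every walk from \<open>u\<close> to \<open>v\<close> costs at least
  \<open>\<delta> v\<close>; by \<open>pred\<close>, stepping back from \<open>v\<close> with
  \<delta> falling by one each time reaches \<open>u\<close> and gives a walk of that cost.\<close>

lemma graph_dist_eqI:
  fixes \<delta> :: "'a \<Rightarrow> nat"
  assumes "pair_wf_digraph G" and u: "u \<in> pverts G" and v: "v \<in> pverts G" and u0: "\<delta> u = 0"
    and arc: "\<And>x y. (x, y) \<in> parcs G \<Longrightarrow> \<delta> y \<le> Suc (\<delta> x)"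
    and pred: "\<And>y. y \<in> pverts G \<Longrightarrow> y \<noteq> u \<Longrightarrow> \<exists>x. (x, y) \<in> parcs G \<and> \<delta> y = Suc (\<delta> x)"
  shows "graph_dist G u v = real (\<delta> v)"
proof -
  interpret pair_wf_digraph G by fact
  have ex: "\<exists>p. awalk u p v \<and> awalk_cost (\<lambda>_. 1) p = real (\<delta> v)" if "v \<in> pverts G" for v
    using that
  proof (induction "\<delta> v" arbitrary: v)
    case 0
    then have "v = u"
      using pred by fastforce
    then show ?case
      using u u0 by (intro exI[of _ "[]"]) (simp add: awalk_Nil_iff)
  next
    case (Suc k)
    then have "v \<noteq> u"
      using u0 by auto
    then obtain x where x: "(x, v) \<in> parcs G" "\<delta> v = Suc (\<delta> x)"
      using pred Suc.prems by blast
    moreover have "x \<in> pverts G"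
      using x(1) by (rule in_arcsD1)
    ultimately obtain p where p: "awalk u p x" "awalk_cost (\<lambda>_. 1) p = real (\<delta> x)"
      using Suc.hyps by fastforce
    have "awalk x [(x, v)] v"
      using x(1) Suc.prems by (simp add: awalk_Cons_iff awalk_Nil_iff)
    with p(1) have "awalk u (p @ [(x, v)]) v"
      by (rule awalk_appendI)
    then show ?case
      using p(2) x(2) by (intro exI[of _ "p @ [(x, v)]"]) simp
  qed
  have le: "real (\<delta> w) \<le> real (\<delta> x) + awalk_cost (\<lambda>_. 1) p" if "awalk x p w" for x p w
    using that
  proof (induction p arbitrary: x)
    case Nil
    then show ?case
      by (simp add: awalk_Nil_iff)
  next
    case (Cons e p)
    then have "awalk (snd e) p w" and "(x, snd e) \<in> parcs G"
      by (auto simp: awalk_Cons_iff)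
    then show ?case
      using Cons.IH[of "snd e"] arc[of x "snd e"] by simp
  qed
  have "\<mu> (\<lambda>_. 1) u v = ereal (real (\<delta> v))"
  proof (rule antisym)
    show "\<mu> (\<lambda>_. 1) u v \<le> ereal (real (\<delta> v))"
      using ex[OF v] min_cost_le_walk_cost by metis
    show "ereal (real (\<delta> v)) \<le> \<mu> (\<lambda>_. 1) u v"
      unfolding \<mu>_def using le[of u _ v] u0 by (auto intro!: INF_greatest)
  qed
  then show ?thesis
    by (simp add: graph_dist_def)
qed

section \<open>Incidence counts in regular graphs\<close>

context pair_graph
begin

lemma doubleton_in_edge_set: "{u, v} \<in> edge_set G \<longleftrightarrow> (u, v) \<in> parcs G"
  using arcs_symmetric by (auto simp: edge_set_def doubleton_eq_iff)

lemma edge_setE: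
  assumes "e \<in> edge_set G"
  obtains u v where "e = {u, v}" "u \<noteq> v" "(u, v) \<in> parcs G" "(v, u) \<in> parcs G"
    "u \<in> pverts G" "v \<in> pverts G"
proof -
  from assms obtain u v where "e = {u, v}" "(u, v) \<in> parcs G"
    by (auto simp: edge_set_def)
  then show thesis
    using that[of u v] no_loops' arcs_symmetric in_arcsD1 in_arcsD2 by blast
qed

lemma edge_subset_pverts: "e \<in> edge_set G \<Longrightarrow> u \<in> e \<Longrightarrow> u \<in> pverts G"
  by (erule edge_setE) auto

lemma finite_edge_set: "finite (edge_set G)"
proof -
  have "edge_set G = (\<lambda>(u, v). {u, v}) ` parcs G"
    by (auto simp: edge_set_def)
  then show ?thesis
    using pair_finite_arcs by simp
qed

lemma sum_edge_ends:
  assumes "e \<in> edge_set G"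
  shows "(\<Sum>v\<in>pverts G. if v \<in> e then c else 0) = 2 * (c :: real)"
  using assms
proof (rule edge_setE)
  fix u v assume e: "e = {u, v}" "u \<noteq> v" "u \<in> pverts G" "v \<in> pverts G"
  then have "pverts G \<inter> {x. x \<in> e} = {u, v}"
    by auto
  then show ?thesis
    using e by (simp add: sum.If_cases pair_finite_verts)
qed

context
  fixes r assumes reg: "regular_graph G r"
begin

lemma card_neighbours:
  assumes "v \<in> pverts G"
  shows "card {u \<in> pverts G. (v, u) \<in> parcs G} = r"
proof -
  have "out_arcs (with_proj G) v = Pair v ` {u \<in> pverts G. (v, u) \<in> parcs G}"
    by (auto simp: out_arcs_def dest: in_arcsD2)
  then have "out_degree (with_proj G) v = card {u \<in> pverts G. (v, u) \<in> parcs G}"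
    by (simp add: out_degree_def card_image inj_on_def)
  then show ?thesis
    using reg assms by (simp add: regular_graph_def)
qed

lemma card_incident_edges:
  assumes "v \<in> pverts G"
  shows "card {e \<in> edge_set G. v \<in> e} = r"
proof -
  have "bij_betw (\<lambda>u. {v, u}) {u \<in> pverts G. (v, u) \<in> parcs G} {e \<in> edge_set G. v \<in> e}"
  proof (rule bij_betwI')
    fix e assume "e \<in> {e \<in> edge_set G. v \<in> e}"
    then have "e \<in> edge_set G" "v \<in> e"
      by auto
    then show "\<exists>u\<in>{u \<in> pverts G. (v, u) \<in> parcs G}. e = {v, u}"
      by (elim edge_setE) (auto simp: insert_commute)
  next
    fix u assume "u \<in> {u \<in> pverts G. (v, u) \<in> parcs G}"
    then show "{v, u} \<in> {e \<in> edge_set G. v \<in> e}"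
      by (simp add: doubleton_in_edge_set)
  qed (simp add: doubleton_eq_iff, blast)
  from bij_betw_same_card[OF this] card_neighbours[OF assms] show ?thesis
    by simp
qed

lemma sum_neighbours:
  "v \<in> pverts G \<Longrightarrow> (\<Sum>u\<in>pverts G. if (v, u) \<in> parcs G then c else 0) = real r * c"
  using card_neighbours by (simp add: sum.If_cases pair_finite_verts Int_def)

lemma sum_incident_edges:
  "v \<in> pverts G \<Longrightarrow> (\<Sum>e\<in>edge_set G. if v \<in> e then c else 0) = real r * c"
  using card_incident_edges by (simp add: sum.If_cases finite_edge_set Int_def)

text \<open>The entrywise form of \<open>B B^T = A + r I\<close> for the incidence matrix
  \<open>B\<close>: distinct \<open>u\<close> and \<open>v\<close> can share only the edge
  \<open>{u, v}\<close>, while \<open>r\<close> edges contain \<open>u\<close> itself.\<close>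

lemma sum_common_edges:
  assumes "u \<in> pverts G"
  shows "(\<Sum>e\<in>edge_set G. if u \<in> e \<and> v \<in> e then c else 0) =
         (if u = v then real r * c else 0) + (if (u, v) \<in> parcs G then c else 0)"
proof (cases "u = v")
  case True
  then show ?thesis
    using assms sum_incident_edges no_loops' by auto
next
  case False
  have "(\<Sum>e\<in>edge_set G. if u \<in> e \<and> v \<in> e then c else 0) = (\<Sum>e\<in>edge_set G. if e = {u, v} then c else 0)"
    using False by (intro sum.cong) (auto elim!: edge_setE)
  then show ?thesis
    using False by (simp add: finite_edge_set doubleton_in_edge_set)
qed

lemma handshake: "2 * card (edge_set G) = card (pverts G) * r"
proof -
  have "(\<Sum>e\<in>edge_set G. \<Sum>v\<in>pverts G. if v \<in> e then 1 else 0) = 2 * real (card (edge_set G))"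
    by (simp add: sum_edge_ends)
  moreover have "(\<Sum>v\<in>pverts G. \<Sum>e\<in>edge_set G. if v \<in> e then 1 else 0) = real (card (pverts G)) * real r"
    by (simp add: sum_incident_edges)
  ultimately have "real (2 * card (edge_set G)) = real (card (pverts G) * r)"
    using sum.swap[of "\<lambda>e v. if v \<in> e then 1 else 0 :: real" "pverts G" "edge_set G"] by simp
  then show ?thesis
    by (simp only: of_nat_eq_iff)
qed

lemma degree_pos:
  assumes "edge_set G \<noteq> {}"
  shows "0 < r"
proof -
  obtain e where "e \<in> edge_set G"
    using assms by blast
  then obtain u where "u \<in> pverts G" "e \<in> {e \<in> edge_set G. u \<in> e}"
    by (auto elim: edge_setE)
  then show ?thesis
    using card_incident_edges finite_edge_set by (metis (no_types, lifting) card_gt_0_iff empty_iff finite_subset mem_Collect_eq subsetI)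
qed

text \<open>By regularity a single edge forces positive degree everywhere, so each original vertex
  has an inserted neighbour through which shortest paths can leave it.\<close>

lemma incident_edgeE:
  assumes "edge_set G \<noteq> {}" "u \<in> pverts G"
  obtains e where "e \<in> edge_set G" "u \<in> e"
proof -
  have "card {e \<in> edge_set G. u \<in> e} \<noteq> 0"
    using card_incident_edges degree_pos assms by simp
  then have "{e \<in> edge_set G. u \<in> e} \<noteq> {}"
    by force
  then show thesis
    using that by blast
qed

end

end

section \<open>Arcs, connectedness and distances of the join\<close>

lemma pverts_join:
  "pverts (subdivision_edge_join G1 G2) =
     (Inl ` Inl ` pverts G1 \<union> Inl ` Inr ` edge_set G1) \<union> (Inr ` Inl ` pverts G2 \<union> Inr ` Inr ` edge_set G2)"
  by (simp add: subdivision_edge_join_def subdivision_graph_def inserted_verts_def image_Un)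

lemma parcs_join [simp]:
  "(Inl (Inl u), Inl (Inl v)) \<notin> parcs (subdivision_edge_join G1 G2)"
  "(Inl (Inl u), Inl (Inr e)) \<in> parcs (subdivision_edge_join G1 G2) \<longleftrightarrow> e \<in> edge_set G1 \<and> u \<in> e"
  "(Inl (Inr e), Inl (Inl u)) \<in> parcs (subdivision_edge_join G1 G2) \<longleftrightarrow> e \<in> edge_set G1 \<and> u \<in> e"
  "(Inl (Inr e), Inl (Inr e')) \<notin> parcs (subdivision_edge_join G1 G2)"
  "(Inr (Inl w), Inr (Inl z)) \<notin> parcs (subdivision_edge_join G1 G2)"
  "(Inr (Inl w), Inr (Inr f)) \<in> parcs (subdivision_edge_join G1 G2) \<longleftrightarrow> f \<in> edge_set G2 \<and> w \<in> f"
  "(Inr (Inr f), Inr (Inl w)) \<in> parcs (subdivision_edge_join G1 G2) \<longleftrightarrow> f \<in> edge_set G2 \<and> w \<in> f"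
  "(Inr (Inr f), Inr (Inr f')) \<notin> parcs (subdivision_edge_join G1 G2)"
  "(Inl (Inl u), Inr y) \<notin> parcs (subdivision_edge_join G1 G2)"
  "(Inr (Inl w), Inl x) \<notin> parcs (subdivision_edge_join G1 G2)"
  "(Inl x, Inr (Inl w)) \<notin> parcs (subdivision_edge_join G1 G2)"
  "(Inr y, Inl (Inl u)) \<notin> parcs (subdivision_edge_join G1 G2)"
  "(Inl (Inr e), Inr (Inr f)) \<in> parcs (subdivision_edge_join G1 G2) \<longleftrightarrow> e \<in> edge_set G1 \<and> f \<in> edge_set G2"
  "(Inr (Inr f), Inl (Inr e)) \<in> parcs (subdivision_edge_join G1 G2) \<longleftrightarrow> e \<in> edge_set G1 \<and> f \<in> edge_set G2"
  by (auto simp: subdivision_edge_join_def subdivision_graph_def inserted_verts_def)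

lemma join_vertex_cases:
  obtains (vert1) u where "x = Inl (Inl u)" | (edge1) e where "x = Inl (Inr e)"
        | (vert2) w where "x = Inr (Inl w)" | (edge2) f where "x = Inr (Inr f)"
  by (metis sum.exhaust)

lemma pair_wf_digraph_join:
  assumes "pair_graph G1" "pair_graph G2"
  shows "pair_wf_digraph (subdivision_edge_join G1 G2)"
proof -
  have "x \<in> pverts (subdivision_edge_join G1 G2) \<and> y \<in> pverts (subdivision_edge_join G1 G2)"
    if "(x, y) \<in> parcs (subdivision_edge_join G1 G2)" for x y
    using that pair_graph.edge_subset_pverts[OF assms(1)] pair_graph.edge_subset_pverts[OF assms(2)]
    by (cases x rule: join_vertex_cases; cases y rule: join_vertex_cases) (auto simp: pverts_join)
  then show ?thesis
    by unfold_locales auto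
qed

text \<open>Arcs between the two sides run between inserted vertices only. If either graph had no
  edge, reachability would preserve \<open>isl\<close>, even in the symmetric closure, and the two
  sides would stay separated.\<close>

lemma connected_join_edges:
  assumes conn: "Digraph_Component.connected (with_proj (subdivision_edge_join G1 G2))"
    and "pverts G1 \<noteq> {}" "pverts G2 \<noteq> {}"
  shows "edge_set G1 \<noteq> {}" "edge_set G2 \<noteq> {}"
proof -
  let ?M = "mk_symmetric (with_proj (subdivision_edge_join G1 G2))"
  have "edge_set G1 \<noteq> {} \<and> edge_set G2 \<noteq> {}"
  proof (rule ccontr)
    assume no_edges: "\<not> ?thesis"
    obtain u w where "u \<in> pverts G1" "w \<in> pverts G2"
      using assms by blast
    then have "reachable (with_proj ?M) (Inl (Inl u)) (Inr (Inl w))"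
      using conn by (auto simp: connected_def strongly_connected_def pverts_join)
    then have "(Inl (Inl u), Inr (Inl w)) \<in> (parcs ?M)\<^sup>*"
      using reachable_rtranclI by fastforce
    moreover have "isl y" if "(x, y) \<in> (parcs ?M)\<^sup>*" "isl x" for x y
      using that
    proof (induction rule: rtrancl_induct)
      case (step y z)
      then show ?case
        using no_edges
        by (cases y rule: join_vertex_cases; cases z rule: join_vertex_cases)
          (auto simp: parcs_mk_symmetric)
    qed
    ultimately show False
      by fastforce
  qed
  then show "edge_set G1 \<noteq> {}" "edge_set G2 \<noteq> {}"
    by auto
qed

text \<open>The values 2 between two edges and 3, 4 between far apart elements of one side come from detours
  through an inserted vertex of the other side.\<close>

fun side_dist :: "'a pair_pre_digraph \<Rightarrow> 'a + 'a set \<Rightarrow> 'a + 'a set \<Rightarrow> nat" where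
  "side_dist G (Inl u) (Inl v) = (if u = v then 0 else if (u, v) \<in> parcs G then 2 else 4)"
| "side_dist G (Inl u) (Inr e) = (if u \<in> e then 1 else 3)"
| "side_dist G (Inr e) (Inl u) = (if u \<in> e then 1 else 3)"
| "side_dist G (Inr e) (Inr f) = (if e = f then 0 else 2)"

fun join_dist :: "'a pair_pre_digraph \<Rightarrow> 'b pair_pre_digraph \<Rightarrow>
    ('a + 'a set) + ('b + 'b set) \<Rightarrow> ('a + 'a set) + ('b + 'b set) \<Rightarrow> nat" where
  "join_dist G1 G2 (Inl x) (Inl y) = side_dist G1 x y"
| "join_dist G1 G2 (Inr x) (Inr y) = side_dist G2 x y"
| "join_dist G1 G2 (Inl x) (Inr y) = of_bool (isl x) + of_bool (isl y) + 1"
| "join_dist G1 G2 (Inr y) (Inl x) = of_bool (isl x) + of_bool (isl y) + 1"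

text \<open>The function \<open>join_dist G1 G2 x\<close> is a potential in the sense of
  \<open>graph_dist_eqI\<close>; the work lies in naming, for each \<open>y\<close>, a neighbour one
  step closer to \<open>x\<close>.\<close>

lemma graph_dist_join:
  assumes G1: "pair_graph G1" and G2: "pair_graph G2"
    and reg: "regular_graph G1 r1" "regular_graph G2 r2"
    and edges: "edge_set G1 \<noteq> {}" "edge_set G2 \<noteq> {}"
    and x: "x \<in> pverts (subdivision_edge_join G1 G2)" and y: "y \<in> pverts (subdivision_edge_join G1 G2)"
  shows "graph_dist (subdivision_edge_join G1 G2) x y = real (join_dist G1 G2 x y)"
proof (rule graph_dist_eqI[OF pair_wf_digraph_join[OF G1 G2] x y])
  show "join_dist G1 G2 x x = 0"
    by (cases x rule: join_vertex_cases) auto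
next
  fix y z assume arc: "(y, z) \<in> parcs (subdivision_edge_join G1 G2)"
  \<comment> \<open>Edges are split into their ends because the two ends of one edge are adjacent,
    hence at distance 2 rather than 4.\<close>
  show "join_dist G1 G2 x z \<le> Suc (join_dist G1 G2 x y)"
    using arc
    by (cases x rule: join_vertex_cases; cases y rule: join_vertex_cases; cases z rule: join_vertex_cases)
      (auto elim!: pair_graph.edge_setE[OF G1] pair_graph.edge_setE[OF G2])
next
  fix y assume y: "y \<in> pverts (subdivision_edge_join G1 G2)" and "y \<noteq> x"
  note doubleton = pair_graph.doubleton_in_edge_set[OF G1] pair_graph.doubleton_in_edge_set[OF G2]
  have inc1: "\<exists>e\<in>edge_set G1. u \<in> e" if "u \<in> pverts G1" for u
    using pair_graph.incident_edgeE[OF G1 reg(1) edges(1) that] by blast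
  have inc2: "\<exists>e\<in>edge_set G2. u \<in> e" if "u \<in> pverts G2" for u
    using pair_graph.incident_edgeE[OF G2 reg(2) edges(2) that] by blast
  obtain e1 e2 where e12: "e1 \<in> edge_set G1" "e2 \<in> edge_set G2"
    using edges by blast
  show "\<exists>z. (z, y) \<in> parcs (subdivision_edge_join G1 G2) \<and> join_dist G1 G2 x y = Suc (join_dist G1 G2 x z)"
  proof (cases x rule: join_vertex_cases)
    case (vert1 u)
    then have u: "u \<in> pverts G1"
      using x by (auto simp: pverts_join)
    then obtain e where e: "e \<in> edge_set G1" "u \<in> e"
      using inc1 by blast
    show ?thesis
    proof (cases y rule: join_vertex_cases)
      case (vert1 w)
      then obtain e' where e': "e' \<in> edge_set G1" "w \<in> e'"
        using inc1 y by (auto simp: pverts_join)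
      show ?thesis
      proof (cases "(u, w) \<in> parcs G1")
        case True
        then show ?thesis
          using \<open>x = Inl (Inl u)\<close> \<open>y = Inl (Inl w)\<close> \<open>y \<noteq> x\<close>
          by (intro exI[of _ "Inl (Inr {u, w})"]) (simp add: doubleton)
      next
        case False
        \<comment> \<open>For nonadjacent \<open>u\<close> and \<open>w\<close> every edge through
          \<open>w\<close> misses \<open>u\<close>, so \<open>e'\<close> lies at distance 3 from
          \<open>u\<close>.\<close>
        have "u \<notin> e'"
        proof
          assume "u \<in> e'"
          then have "e' = {u, w}"
            using e' \<open>x = Inl (Inl u)\<close> \<open>y = Inl (Inl w)\<close> \<open>y \<noteq> x\<close>
            by (auto elim!: pair_graph.edge_setE[OF G1])
          then show False
            using e' False doubleton by simp
        qed
        then show ?thesis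
          using \<open>x = Inl (Inl u)\<close> \<open>y = Inl (Inl w)\<close> \<open>y \<noteq> x\<close> e' False
          by (intro exI[of _ "Inl (Inr e')"]) simp
      qed
    next
      case (edge1 e')
      then show ?thesis
      proof (cases "u \<in> e'")
        case True
        then show ?thesis
          using vert1 edge1 y by (intro exI[of _ x]) (auto simp: pverts_join)
      next
        \<comment> \<open>The detour to \<open>e'\<close> runs through an edge at \<open>u\<close>
          and then \<open>e2\<close>, which is at distance 2.\<close>
        case False
        then show ?thesis
          using vert1 edge1 y e12 by (intro exI[of _ "Inr (Inr e2)"]) (auto simp: pverts_join)
      qed
    next
      case (vert2 w)
      then obtain f where "f \<in> edge_set G2" "w \<in> f"
        using inc2 y by (auto simp: pverts_join)
      then show ?thesis
        using vert2 vert1 by (intro exI[of _ "Inr (Inr f)"]) simp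
    next
      case (edge2 f)
      then show ?thesis
        using vert1 e y by (intro exI[of _ "Inl (Inr e)"]) (auto simp: pverts_join)
    qed
  next
    case (edge1 e)
    then have e: "e \<in> edge_set G1"
      using x by (auto simp: pverts_join)
    show ?thesis
    proof (cases y rule: join_vertex_cases)
      case (vert1 w)
      then obtain e' where e': "e' \<in> edge_set G1" "w \<in> e'"
        using inc1 y by (auto simp: pverts_join)
      \<comment> \<open>If \<open>e\<close> contains \<open>w\<close> it is itself the predecessor,
        at distance 0; otherwise \<open>e'\<close> is, at distance 2.\<close>
      show ?thesis
        using e e' edge1 vert1
        by (intro exI[of _ "Inl (Inr (if w \<in> e then e else e'))"]) auto
    next
      case (edge1 e')
      then show ?thesis
        using \<open>x = Inl (Inr e)\<close> \<open>y \<noteq> x\<close> y e12 by (intro exI[of _ "Inr (Inr e2)"]) (auto simp: pverts_join)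
    next
      case (vert2 w)
      then obtain f where "f \<in> edge_set G2" "w \<in> f"
        using inc2 y by (auto simp: pverts_join)
      then show ?thesis
        using vert2 edge1 by (intro exI[of _ "Inr (Inr f)"]) simp
    next
      case (edge2 f)
      then show ?thesis
        using edge1 e y by (intro exI[of _ x]) (auto simp: pverts_join)
    qed
  next
    \<comment> \<open>The other two cases mirror these with the sides exchanged.\<close>
    case (vert2 u)
    then have u: "u \<in> pverts G2"
      using x by (auto simp: pverts_join)
    then obtain e where e: "e \<in> edge_set G2" "u \<in> e"
      using inc2 by blast
    show ?thesis
    proof (cases y rule: join_vertex_cases)
      case (vert2 w)
      then obtain e' where e': "e' \<in> edge_set G2" "w \<in> e'"
        using inc2 y by (auto simp: pverts_join)
      show ?thesis
      proof (cases "(u, w) \<in> parcs G2")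
        case True
        then show ?thesis
          using \<open>x = Inr (Inl u)\<close> \<open>y = Inr (Inl w)\<close> \<open>y \<noteq> x\<close>
          by (intro exI[of _ "Inr (Inr {u, w})"]) (simp add: doubleton)
      next
        case False
        have "u \<notin> e'"
        proof
          assume "u \<in> e'"
          then have "e' = {u, w}"
            using e' \<open>x = Inr (Inl u)\<close> \<open>y = Inr (Inl w)\<close> \<open>y \<noteq> x\<close>
            by (auto elim!: pair_graph.edge_setE[OF G2])
          then show False
            using e' False doubleton by simp
        qed
        then show ?thesis
          using \<open>x = Inr (Inl u)\<close> \<open>y = Inr (Inl w)\<close> \<open>y \<noteq> x\<close> e' False
          by (intro exI[of _ "Inr (Inr e')"]) simp
      qed
    next
      case (edge2 e')
      then show ?thesis
      proof (cases "u \<in> e'")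
        case True
        then show ?thesis
          using vert2 edge2 y by (intro exI[of _ x]) (auto simp: pverts_join)
      next
        case False
        then show ?thesis
          using vert2 edge2 y e12 by (intro exI[of _ "Inl (Inr e1)"]) (auto simp: pverts_join)
      qed
    next
      case (vert1 w)
      then obtain f where "f \<in> edge_set G1" "w \<in> f"
        using inc1 y by (auto simp: pverts_join)
      then show ?thesis
        using vert1 vert2 by (intro exI[of _ "Inl (Inr f)"]) simp
    next
      case (edge1 f)
      then show ?thesis
        using vert2 e y by (intro exI[of _ "Inr (Inr e)"]) (auto simp: pverts_join)
    qed
  next
    case (edge2 e)
    then have e: "e \<in> edge_set G2"
      using x by (auto simp: pverts_join)
    show ?thesis
    proof (cases y rule: join_vertex_cases)
      case (vert2 w)
      then obtain e' where e': "e' \<in> edge_set G2" "w \<in> e'"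
        using inc2 y by (auto simp: pverts_join)
      show ?thesis
        using e e' edge2 vert2
        by (intro exI[of _ "Inr (Inr (if w \<in> e then e else e'))"]) auto
    next
      case (edge2 e')
      then show ?thesis
        using \<open>x = Inr (Inr e)\<close> \<open>y \<noteq> x\<close> y e12 by (intro exI[of _ "Inl (Inr e1)"]) (auto simp: pverts_join)
    next
      case (vert1 w)
      then obtain f where "f \<in> edge_set G1" "w \<in> f"
        using inc1 y by (auto simp: pverts_join)
      then show ?thesis
        using vert1 edge2 by (intro exI[of _ "Inl (Inr f)"]) simp
    next
      case (edge1 f)
      then show ?thesis
        using edge2 e y by (intro exI[of _ x]) (auto simp: pverts_join)
    qed
  qed
qed

section \<open>The two sides of the join\<close>

fun side_core :: "'a pair_pre_digraph \<Rightarrow> real \<Rightarrow> real \<Rightarrow> 'a + 'a set \<Rightarrow> 'a + 'a set \<Rightarrow> real" where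
  "side_core G a b (Inl u) (Inl v) = (if u = v then a else 0) - (if (u, v) \<in> parcs G then 2 else 0)"
| "side_core G a b (Inl u) (Inr e) = - (if u \<in> e then 2 else 0)"
| "side_core G a b (Inr e) (Inl u) = - (if u \<in> e then 2 else 0)"
| "side_core G a b (Inr e) (Inr f) = (if e = f then b else 0)"

text \<open>The characteristic polynomial of the block of \<open>side_core\<close> on the span of an eigenvector of the
  adjacency matrix and its image under the incidence matrix.\<close>

definition side_factor :: "real \<Rightarrow> real \<Rightarrow> real \<Rightarrow> real \<Rightarrow> real poly" where
  "side_factor a b r l = [:- b, 1:] * [:2 * l - a, 1:] - [:4 * (l + r):]"

lemma adjacency_matrix_eq_list_mat:
  "adjacency_matrix vs G = list_mat vs vs (\<lambda>u v. if (u, v) \<in> parcs G then 1 else 0)"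
  by (simp add: adjacency_matrix_def list_mat_def)

context pair_graph
begin

context
  fixes r vs es
  assumes reg: "regular_graph G r" and vs: "vertex_listing vs G"
    and es: "distinct es" "set es = edge_set G"
begin

text \<open>Multiplying \<open>t I - S\<close> on the right by the block matrix with rows \<open>(y I, 0)\<close> and \<open>(- C, I)\<close>,
  where \<open>y = t - b\<close>, clears the lower left block; since \<open>B C\<close> is 4 times \<open>A + r I\<close>, the upper left block becomes affine in \<open>A\<close>.\<close>

lemma char_poly_side_core:
  assumes L: "char_poly (adjacency_matrix vs G) = (\<Prod>l\<in>#L. [:- l, 1:])"
  shows "char_poly (list_mat (map Inl vs @ map Inr es) (map Inl vs @ map Inr es) (side_core G a b)) *
           [:- b, 1:] ^ length vs =
         [:- b, 1:] ^ length es * (\<Prod>l\<in>#L. side_factor a b r l)"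
    (is "char_poly ?S * _ = _")
proof (rule poly_ext)
  fix t
  define y where "y = t - b"
  have dv: "distinct vs" "set vs = pverts G"
    using vs by (auto simp: vertex_listing_def)
  let ?n = "length vs" and ?m = "length es"
  let ?B = "list_mat vs es (\<lambda>u e. if u \<in> e then 2 else 0 :: real)"
  let ?P = "list_mat vs vs (\<lambda>u v. (if u = v then t - a else 0) + (if (u, v) \<in> parcs G then 2 else 0))"
  let ?C = "list_mat es vs (\<lambda>e u. if u \<in> e then 2 else 0 :: real)"
  let ?D = "list_mat es es (\<lambda>e f. if e = f then y else 0)"
  let ?Y = "list_mat vs vs (\<lambda>u v. if u = v then y else 0)"
  let ?C' = "list_mat es vs (\<lambda>e u. - (if u \<in> e then 2 else 0 :: real))"
  \<comment> \<open>\<open>?P * ?Y\<close> is \<open>y (t - a) I + 2 y A\<close> and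
    \<open>?B * ?C'\<close> is \<open>- 4 (A + r I)\<close>; \<open>?f\<close> and \<open>?g\<close>
    collect the coefficients of \<open>I\<close> and \<open>A\<close>.\<close>
  let ?f = "y * (t - a) - 4 * real r" and ?g = "2 * y - 4"
  have "poly (char_poly ?S) t = det (four_block_mat ?P ?B ?C ?D)"
    using es dv
    by (subst poly_char_poly_list_mat)
      (auto simp: distinct_map list_mat_append list_mat_map y_def
        intro!: arg_cong[of _ _ det] cong_four_block_mat list_mat_cong)
  \<comment> \<open>The source of the power of \<open>[:- b, 1:]\<close> on the left of the claim;
    keeping it there avoids dividing by \<open>y\<close>, which may be zero.\<close>
  moreover have "det (four_block_mat ?Y (0\<^sub>m ?n ?m) ?C' (1\<^sub>m ?m)) = y ^ ?n"
  proof -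
    have "?Y = y \<cdot>\<^sub>m 1\<^sub>m ?n"
      by (rule eq_matI) (auto simp: nth_eq_iff_index_eq dv)
    then have "det ?Y = y ^ ?n"
      by simp
    then show ?thesis
      by (subst det_four_block_mat_upper_right_zero[of _ ?n _ ?m]) auto
  qed
  moreover have "det (four_block_mat ?P ?B ?C ?D * four_block_mat ?Y (0\<^sub>m ?n ?m) ?C' (1\<^sub>m ?m)) =
      y ^ ?m * (\<Prod>l\<in>#L. ?f + ?g * l)"
  proof -
    have 1: "?P * ?Y + ?B * ?C' = ?f \<cdot>\<^sub>m 1\<^sub>m ?n + ?g \<cdot>\<^sub>m adjacency_matrix vs G"
    proof -
      have "?P * ?Y + ?B * ?C' = list_mat vs vs (\<lambda>u v.
          (if u = v then ?f else 0) + ?g * (if (u, v) \<in> parcs G then 1 else 0))"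
        unfolding list_mat_mult[OF dv(1)] list_mat_mult[OF es(1)] list_mat_add
      proof (rule list_mat_cong)
        fix u v assume "u \<in> set vs" "v \<in> set vs"
        then have uv: "u \<in> pverts G" "v \<in> pverts G"
          by (auto simp: dv)
        let ?p = "\<lambda>w. (if u = w then t - a else 0) + (if (u, w) \<in> parcs G then 2 else 0)"
        have "(\<Sum>w\<in>set vs. ?p w * (if w = v then y else 0)) = (\<Sum>w\<in>pverts G. if w = v then ?p w * y else 0)"
          unfolding dv by (rule sum.cong) auto
        also have "\<dots> = ?p v * y"
          using uv pair_finite_verts by simp
        finally have *: "(\<Sum>w\<in>set vs. ?p w * (if w = v then y else 0)) = ?p v * y" .
        have "(\<Sum>e\<in>set es. (if u \<in> e then 2 else 0) * - (if v \<in> e then 2 else 0)) =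
              (\<Sum>e\<in>edge_set G. if u \<in> e \<and> v \<in> e then - 4 else 0 :: real)"
          unfolding es by (rule sum.cong) auto
        then show "(\<Sum>w\<in>set vs. ?p w * (if w = v then y else 0)) +
            (\<Sum>e\<in>set es. (if u \<in> e then 2 else 0) * - (if v \<in> e then 2 else 0)) =
            (if u = v then ?f else 0) + ?g * (if (u, v) \<in> parcs G then 1 else 0)"
          unfolding * using uv no_loops' by (auto simp: sum_common_edges[OF reg] algebra_simps)
      qed
      also have "\<dots> = ?f \<cdot>\<^sub>m 1\<^sub>m ?n + ?g \<cdot>\<^sub>m adjacency_matrix vs G"
        unfolding adjacency_matrix_eq_list_mat by (rule eq_matI) (auto simp: nth_eq_iff_index_eq dv)
      finally show ?thesis .
    qed
    have 2: "?C * ?Y + ?D * ?C' = 0\<^sub>m ?m ?n"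
      unfolding list_mat_mult[OF dv(1)] list_mat_mult[OF es(1)] list_mat_add list_mat_const_zero[symmetric]
    proof (rule list_mat_cong)
      fix e v assume ev: "e \<in> set es" "v \<in> set vs"
      have "(\<Sum>w\<in>set vs. (if w \<in> e then 2 else 0) * (if w = v then y else 0)) =
            (\<Sum>w\<in>set vs. if w = v then (if w \<in> e then 2 else 0) * y else 0)"
        by (rule sum.cong) auto
      moreover have "(\<Sum>f\<in>set es. (if e = f then y else 0) * - (if v \<in> f then 2 else 0)) =
            (\<Sum>f\<in>set es. if e = f then y * - (if v \<in> f then 2 else 0) else 0)"
        by (rule sum.cong) auto
      ultimately show "(\<Sum>w\<in>set vs. (if w \<in> e then 2 else 0) * (if w = v then y else 0)) +
          (\<Sum>f\<in>set es. (if e = f then y else 0) * - (if v \<in> f then 2 else 0)) = 0"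
        using ev by simp
    qed
    have "?D = y \<cdot>\<^sub>m 1\<^sub>m ?m"
      by (rule eq_matI) (auto simp: nth_eq_iff_index_eq es)
    then have D: "det ?D = y ^ ?m"
      by simp
    have "four_block_mat ?P ?B ?C ?D * four_block_mat ?Y (0\<^sub>m ?n ?m) ?C' (1\<^sub>m ?m) =
        four_block_mat (?P * ?Y + ?B * ?C') (?P * 0\<^sub>m ?n ?m + ?B * 1\<^sub>m ?m)
          (?C * ?Y + ?D * ?C') (?C * 0\<^sub>m ?n ?m + ?D * 1\<^sub>m ?m)"
      by (rule mult_four_block_mat[of _ ?n ?n _ ?m _ ?m _ _ ?n _ ?m]) auto
    also have "\<dots> = four_block_mat (?f \<cdot>\<^sub>m 1\<^sub>m ?n + ?g \<cdot>\<^sub>m adjacency_matrix vs G) ?B (0\<^sub>m ?m ?n) ?D"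
      unfolding 1 2 by (intro cong_four_block_mat refl) (auto intro!: eq_matI)
    also have "det \<dots> = det (?f \<cdot>\<^sub>m 1\<^sub>m ?n + ?g \<cdot>\<^sub>m adjacency_matrix vs G) * det ?D"
      by (rule det_four_block_mat_lower_left_zero[of _ ?n _ ?m]) (auto simp: adjacency_matrix_def)
    also have "\<dots> = y ^ ?m * (\<Prod>l\<in>#L. ?f + ?g * l)"
      using det_affine_of_char_poly[OF _ L, of ?n ?f ?g]
      by (simp add: D adjacency_matrix_eq_list_mat)
    finally show ?thesis .
  qed
  moreover have "det (four_block_mat ?P ?B ?C ?D * four_block_mat ?Y (0\<^sub>m ?n ?m) ?C' (1\<^sub>m ?m)) =
      det (four_block_mat ?P ?B ?C ?D) * det (four_block_mat ?Y (0\<^sub>m ?n ?m) ?C' (1\<^sub>m ?m))"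
    by (rule det_mult[of _ "?n + ?m"]) auto
  moreover have "poly (\<Prod>l\<in>#L. side_factor a b r l) t = (\<Prod>l\<in>#L. ?f + ?g * l)"
    by (induction L) (simp_all add: side_factor_def y_def algebra_simps)
  ultimately show "poly (char_poly ?S * [:- b, 1:] ^ length vs) t =
      poly ([:- b, 1:] ^ length es * (\<Prod>l\<in>#L. side_factor a b r l)) t"
    by (simp add: poly_power y_def)
qed

text \<open>With incidence matrix \<open>B\<close>, the matrix \<open>A + r I = B B\<^sup>T\<close> is positive semidefinite.\<close>

lemma adjacency_eigenvalue_ge:
  assumes root: "poly (char_poly (adjacency_matrix vs G)) l = 0"
  shows "- real r \<le> l"
proof -
  have dv: "distinct vs" "set vs = pverts G"
    using vs by (auto simp: vertex_listing_def)
  let ?A = "adjacency_matrix vs G" and ?n = "length vs"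
  have A: "?A \<in> carrier_mat ?n ?n"
    by (simp add: adjacency_matrix_eq_list_mat)
  have "eigenvalue ?A l"
    using root eigenvalue_root_char_poly[OF A] by simp
  then obtain v where v: "v \<in> carrier_vec ?n" "v \<noteq> 0\<^sub>v ?n" "?A *\<^sub>v v = l \<cdot>\<^sub>v v"
    using A by (auto simp: eigenvalue_def eigenvector_def)
  have Av: "(\<Sum>j<?n. (if (vs ! i, vs ! j) \<in> parcs G then 1 else 0) * v $ j) = l * v $ i" if "i < ?n" for i
    using arg_cong[OF v(3), of "\<lambda>w. w $ i"] that v(1)
    by (simp add: adjacency_matrix_def scalar_prod_def atLeast0LessThan)
  let ?I = "\<lambda>i e. if vs ! i \<in> e then 1 else 0 :: real"
  \<comment> \<open>The chain computes the squared norm of \<open>B^T v\<close> as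
    \<open>v^T (A + r I) v\<close>, that is, \<open>r + l\<close> times the squared norm of
    \<open>v\<close>.\<close>
  have "0 \<le> (\<Sum>e\<in>edge_set G. (\<Sum>i<?n. ?I i e * v $ i)\<^sup>2)"
    by (intro sum_nonneg) simp
  also have "\<dots> = (\<Sum>e\<in>edge_set G. \<Sum>i<?n. \<Sum>j<?n. (?I i e * ?I j e) * (v $ i * v $ j))"
    by (simp only: power2_eq_square sum_product) (simp only: mult_ac)
  also have "\<dots> = (\<Sum>i<?n. \<Sum>e\<in>edge_set G. \<Sum>j<?n. (?I i e * ?I j e) * (v $ i * v $ j))"
    by (rule sum.swap)
  also have "\<dots> = (\<Sum>i<?n. \<Sum>j<?n. \<Sum>e\<in>edge_set G. (?I i e * ?I j e) * (v $ i * v $ j))"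
    by (intro sum.cong refl sum.swap)
  also have "\<dots> = (\<Sum>i<?n. (real r + l) * (v $ i)\<^sup>2)"
  proof (rule sum.cong[OF refl])
    fix i assume "i \<in> {..<?n}"
    then have i: "i < ?n" "vs ! i \<in> pverts G"
      using dv nth_mem by auto
    have "(\<Sum>e\<in>edge_set G. (?I i e * ?I j e) * (v $ i * v $ j)) =
        (if i = j then real r * (v $ i)\<^sup>2 else 0) +
        v $ i * ((if (vs ! i, vs ! j) \<in> parcs G then 1 else 0) * v $ j)" if j: "j < ?n" for j
    proof -
      have "(\<Sum>e\<in>edge_set G. (?I i e * ?I j e) * (v $ i * v $ j)) =
          (\<Sum>e\<in>edge_set G. if vs ! i \<in> e \<and> vs ! j \<in> e then v $ i * v $ j else 0)"
        by (rule sum.cong) auto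
      then show ?thesis
        using i j dv(1) by (simp add: sum_common_edges[OF reg] nth_eq_iff_index_eq power2_eq_square)
    qed
    then have "(\<Sum>j<?n. \<Sum>e\<in>edge_set G. (?I i e * ?I j e) * (v $ i * v $ j)) =
        (\<Sum>j<?n. (if i = j then real r * (v $ i)\<^sup>2 else 0) +
        v $ i * ((if (vs ! i, vs ! j) \<in> parcs G then 1 else 0) * v $ j))"
      by (intro sum.cong) auto
    also have "\<dots> = real r * (v $ i)\<^sup>2 + v $ i * (l * v $ i)"
      unfolding sum.distrib sum_distrib_left[symmetric] Av[OF i(1)] using i by simp
    also have "\<dots> = (real r + l) * (v $ i)\<^sup>2"
      by (simp add: power2_eq_square algebra_simps)
    finally show "(\<Sum>j<?n. \<Sum>e\<in>edge_set G. (?I i e * ?I j e) * (v $ i * v $ j)) = (real r + l) * (v $ i)\<^sup>2" .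
  qed
  also have "\<dots> = (real r + l) * (\<Sum>i<?n. (v $ i)\<^sup>2)"
    by (simp add: sum_distrib_left)
  finally have "0 \<le> (real r + l) * (\<Sum>i<?n. (v $ i)\<^sup>2)" .
  moreover have "0 < (\<Sum>i<?n. (v $ i)\<^sup>2)"
  proof -
    obtain i where "i < ?n" "v $ i \<noteq> 0"
      using v(1,2) by (auto simp: vec_eq_iff)
    then show ?thesis
      by (intro sum_pos2[of _ i]) auto
  qed
  ultimately show ?thesis
    by (simp add: zero_le_mult_iff)
qed

end

end

section \<open>Row sums over the vertex classes\<close>

context pair_graph
begin

context
  fixes r m :: nat
  assumes reg: "regular_graph G r" and m: "card (edge_set G) = m"
begin

text \<open>Each distance is a generic constant minus corrections at equal, adjacent or incident
  elements, and the degree and the two ends of an edge fix how many of these occur.\<close>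

lemma sum_side_dist:
  "u \<in> pverts G \<Longrightarrow>
     (\<Sum>v\<in>pverts G. real (side_dist G (Inl u) (Inl v))) = 4 * real (card (pverts G)) - 4 - 2 * real r"
  "u \<in> pverts G \<Longrightarrow> (\<Sum>e\<in>edge_set G. real (side_dist G (Inl u) (Inr e))) = 3 * real m - 2 * real r"
  "e \<in> edge_set G \<Longrightarrow> (\<Sum>v\<in>pverts G. real (side_dist G (Inr e) (Inl v))) = 3 * real (card (pverts G)) - 4"
  "e \<in> edge_set G \<Longrightarrow> (\<Sum>f\<in>edge_set G. real (side_dist G (Inr e) (Inr f))) = 2 * real m - 2"
proof -
  assume u: "u \<in> pverts G"
  have "(\<Sum>v\<in>pverts G. real (side_dist G (Inl u) (Inl v))) =
        (\<Sum>v\<in>pverts G. 4 - (if u = v then 4 else 0) - (if (u, v) \<in> parcs G then 2 else 0))"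
    using no_loops' by (intro sum.cong) auto
  also have "\<dots> = 4 * real (card (pverts G)) - 4 - 2 * real r"
    using u by (simp add: sum_subtractf sum_neighbours[OF reg] pair_finite_verts)
  finally show "(\<Sum>v\<in>pverts G. real (side_dist G (Inl u) (Inl v))) = 4 * real (card (pverts G)) - 4 - 2 * real r" .
  have "(\<Sum>e\<in>edge_set G. real (side_dist G (Inl u) (Inr e))) = (\<Sum>e\<in>edge_set G. 3 - (if u \<in> e then 2 else 0))"
    by (intro sum.cong) auto
  also have "\<dots> = 3 * real m - 2 * real r"
    using u by (simp add: sum_subtractf sum_incident_edges[OF reg] m)
  finally show "(\<Sum>e\<in>edge_set G. real (side_dist G (Inl u) (Inr e))) = 3 * real m - 2 * real r" .
next
  assume e: "e \<in> edge_set G"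
  have "(\<Sum>v\<in>pverts G. real (side_dist G (Inr e) (Inl v))) = (\<Sum>v\<in>pverts G. 3 - (if v \<in> e then 2 else 0))"
    by (intro sum.cong) auto
  also have "\<dots> = 3 * real (card (pverts G)) - 4"
    using e by (simp add: sum_subtractf sum_edge_ends)
  finally show "(\<Sum>v\<in>pverts G. real (side_dist G (Inr e) (Inl v))) = 3 * real (card (pverts G)) - 4" .
  have "(\<Sum>f\<in>edge_set G. real (side_dist G (Inr e) (Inr f))) = (\<Sum>f\<in>edge_set G. 2 - (if e = f then 2 else 0))"
    by (intro sum.cong) auto
  also have "\<dots> = 2 * real m - 2"
    using e by (simp add: sum_subtractf finite_edge_set m)
  finally show "(\<Sum>f\<in>edge_set G. real (side_dist G (Inr e) (Inr f))) = 2 * real m - 2" .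
qed

text \<open>That these sums depend only on the class makes the partition equitable; they are entries
  of \<open>core_quotient\<close>.\<close>

lemma sum_side_core:
  "u \<in> pverts G \<Longrightarrow> (\<Sum>v\<in>pverts G. side_core G a b (Inl u) (Inl v)) = a - 2 * real r"
  "u \<in> pverts G \<Longrightarrow> (\<Sum>e\<in>edge_set G. side_core G a b (Inl u) (Inr e)) = - 2 * real r"
  "e \<in> edge_set G \<Longrightarrow> (\<Sum>v\<in>pverts G. side_core G a b (Inr e) (Inl v)) = - 4"
  "e \<in> edge_set G \<Longrightarrow> (\<Sum>f\<in>edge_set G. side_core G a b (Inr e) (Inr f)) = b"
  by (simp_all add: sum_subtractf sum_negf sum_neighbours[OF reg] sum_incident_edges[OF reg]
      sum_edge_ends pair_finite_verts finite_edge_set)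

end

end

lemma sum_pverts_join:
  assumes "pair_graph G1" "pair_graph G2"
  shows "(\<Sum>x\<in>pverts (subdivision_edge_join G1 G2). F x) =
      (\<Sum>u\<in>pverts G1. F (Inl (Inl u))) + (\<Sum>e\<in>edge_set G1. F (Inl (Inr e))) +
      ((\<Sum>w\<in>pverts G2. F (Inr (Inl w))) + (\<Sum>f\<in>edge_set G2. F (Inr (Inr f))))"
proof -
  interpret G1: pair_graph G1 by fact
  interpret G2: pair_graph G2 by fact
  show ?thesis
    unfolding pverts_join
    using G1.pair_finite_verts G2.pair_finite_verts G1.finite_edge_set G2.finite_edge_set
    by (subst sum.union_disjoint; (subst sum.union_disjoint)?; (subst sum.union_disjoint)?)
      (auto simp: sum.reindex inj_on_def)
qed

section \<open>The spectrum of the join\<close>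

text \<open>The numbering follows the order of the rows of \<open>quotient_matrix\<close>.\<close>

fun join_class :: "('a + 'a set) + ('b + 'b set) \<Rightarrow> nat" where
  "join_class (Inl (Inl u)) = 0"
| "join_class (Inl (Inr e)) = 1"
| "join_class (Inr (Inl w)) = 2"
| "join_class (Inr (Inr f)) = 3"

fun join_core :: "'a pair_pre_digraph \<Rightarrow> 'b pair_pre_digraph \<Rightarrow> real \<Rightarrow> real \<Rightarrow> real \<Rightarrow> real \<Rightarrow>
    ('a + 'a set) + ('b + 'b set) \<Rightarrow> ('a + 'a set) + ('b + 'b set) \<Rightarrow> real" where
  "join_core G1 G2 a1 b1 a2 b2 (Inl x) (Inl y) = side_core G1 a1 b1 x y"
| "join_core G1 G2 a1 b1 a2 b2 (Inr x) (Inr y) = side_core G2 a2 b2 x y"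
| "join_core G1 G2 a1 b1 a2 b2 (Inl x) (Inr y) = 0"
| "join_core G1 G2 a1 b1 a2 b2 (Inr x) (Inl y) = 0"

text \<open>Generic distance between two classes: equal, adjacent or incident pairs deviate from it inside one
  side only, and these deviations make up \<open>join_core\<close>.\<close>

definition class_dist :: "nat \<Rightarrow> nat \<Rightarrow> real" where
  "class_dist k l = [[4, 3, 3, 2], [3, 2, 2, 1], [3, 2, 4, 3], [2, 1, 3, 2]] ! k ! l"

text \<open>The matrix \<open>E\<close>: row sums of \<open>join_core\<close>, from a vertex of
  class \<open>k\<close> over class \<open>l\<close>.\<close>

definition core_quotient :: "real \<Rightarrow> real \<Rightarrow> real \<Rightarrow> real \<Rightarrow> real \<Rightarrow> real \<Rightarrow> nat \<Rightarrow> nat \<Rightarrow> real" where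
  "core_quotient a1 b1 r1 a2 b2 r2 k l =
     [[a1 - 2 * r1, - 2 * r1, 0, 0], [- 4, b1, 0, 0],
      [0, 0, a2 - 2 * r2, - 2 * r2], [0, 0, - 4, b2]] ! k ! l"

text \<open>In each diagonal block the off-diagonal product is \<open>8 * r\<close>, which is
  \<open>4 * (l + r)\<close> at \<open>l = r\<close>. So these are the factors of the trivial
  adjacency eigenvalues, which cancel later.\<close>

lemma char_poly_core_quotient:
  "char_poly (list_mat [0, 1, 2, 3] [0, 1, 2, 3] (core_quotient a1 b1 r1 a2 b2 r2)) =
     side_factor a1 b1 r1 r1 * side_factor a2 b2 r2 r2"
proof -
  let ?q = "core_quotient a1 b1 r1 a2 b2 r2"
  have blocks: "list_mat [0, 1, 2, 3] [0, 1, 2, 3] ?q =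
      four_block_mat (list_mat [0, 1] [0, 1] ?q) (0\<^sub>m 2 2) (list_mat [2, 3] [0, 1] ?q)
        (list_mat [2, 3] [2, 3] ?q)"
  proof -
    have "list_mat [0, 1] [2, 3] ?q = list_mat [0, 1 :: nat] [2, 3 :: nat] (\<lambda>_ _. 0)"
      by (rule list_mat_cong) (auto simp: core_quotient_def)
    then show ?thesis
      using list_mat_append[of "[0, 1]" "[2, 3]" "[0, 1]" "[2, 3]" ?q]
      by (simp add: list_mat_const_zero numeral_2_eq_2)
  qed
  have "char_poly (list_mat [0, 1, 2, 3] [0, 1, 2, 3] ?q) = char_poly (list_mat [0, 1] [0, 1] ?q) * char_poly (list_mat [2, 3] [2, 3] ?q)"
    unfolding blocks by (rule char_poly_block_upper_right_zero) (simp_all add: carrier_matI)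
  also have "\<dots> = side_factor a1 b1 r1 r1 * side_factor a2 b2 r2 r2"
    by (simp add: char_poly_list_mat_two core_quotient_def side_factor_def mult.commute[of b1] mult.commute[of b2])
  finally show ?thesis .
qed

text \<open>The quadratic \<open>(x - b) * (x - a + 2 * l) - 4 * (l + r)\<close> has half-sum of
  roots \<open>c\<close> and discriminant \<open>D\<close>; the bound on \<open>l\<close> makes
  \<open>D\<close> nonnegative, so that \<open>sqrt D\<close> squares to \<open>D\<close>.\<close>

lemma side_factor_split:
  assumes "- r \<le> l" and c: "c = (a + b) / 2 - l" and D: "D = (a - 2 * l - b)\<^sup>2 + 16 * (l + r)"
  shows "side_factor a b r l = (\<Prod>x\<in>#plus_minus c (1 / 2 * sqrt D). [:- x, 1:])"
proof -
  have "0 \<le> D"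
    using assms by simp
  then have "(sqrt D)\<^sup>2 = (a - 2 * l - b)\<^sup>2 + 16 * (l + r)"
    by (simp add: D)
  then have "c * c - (1 / 2 * sqrt D) * (1 / 2 * sqrt D) = b * (a - 2 * l) - 4 * (l + r)"
    by (simp add: c power2_eq_square field_simps)
  then show ?thesis
    by (simp add: side_factor_def plus_minus_def c algebra_simps)
qed


lemma distance_signless_laplacian_eq_list_mat:
  "distinct vs \<Longrightarrow> distance_signless_laplacian vs G =
     list_mat vs vs (\<lambda>x y. (if x = y then transmission G x else 0) + graph_dist G x y)"
  by (rule eq_matI)
    (auto simp: distance_signless_laplacian_def transmission_matrix_def distance_matrix_def
      mat_diag_def nth_eq_iff_index_eq)

text \<open>Transmission of an original (resp. inserted) vertex, minus the generic distance 4 (resp. 2) within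
  its class. The arguments are orders \<open>p\<close>, degree \<open>r\<close> and sizes \<open>m\<close>, with primes for the other graph.\<close>

definition vert_diag :: "real \<Rightarrow> real \<Rightarrow> real \<Rightarrow> real \<Rightarrow> real \<Rightarrow> real" where
  "vert_diag p r m p' m' = 4 * p - 8 - 4 * r + 3 * m + 3 * p' + 2 * m'"

definition edge_diag :: "real \<Rightarrow> real \<Rightarrow> real \<Rightarrow> real \<Rightarrow> real" where
  "edge_diag p m p' m' = 3 * p + 2 * m - 8 + 2 * p' + m'"

section \<open>Laplacian, quotient matrix and characteristic polynomial of the join\<close>

context
  fixes G1 :: "'a pair_pre_digraph" and G2 :: "'b pair_pre_digraph"
    and p1 p2 r1 r2 m1 m2 :: nat
  assumes G1: "pair_graph G1" and G2: "pair_graph G2"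
    and p: "card (pverts G1) = p1" "card (pverts G2) = p2"
    and reg: "regular_graph G1 r1" "regular_graph G2 r2"
    and m: "card (edge_set G1) = m1" "card (edge_set G2) = m2"
    and edges: "edge_set G1 \<noteq> {}" "edge_set G2 \<noteq> {}"
begin

private abbreviation (input) "J \<equiv> subdivision_edge_join G1 G2"
private abbreviation (input) "a1 \<equiv> vert_diag (real p1) (real r1) (real m1) (real p2) (real m2)"
private abbreviation (input) "a2 \<equiv> vert_diag (real p2) (real r2) (real m2) (real p1) (real m1)"
private abbreviation (input) "b1 \<equiv> edge_diag (real p1) (real m1) (real p2) (real m2)"
private abbreviation (input) "b2 \<equiv> edge_diag (real p2) (real m2) (real p1) (real m1)"

text \<open>The summands 4 and 2 are the diagonal of \<open>class_dist\<close>, which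
  \<open>vert_diag\<close> and \<open>edge_diag\<close> leave out.\<close>

lemma transmission_join:
  assumes "x \<in> pverts J"
  shows "transmission J x = [a1 + 4, b1 + 2, a2 + 4, b2 + 2] ! join_class x"
proof -
  have "transmission J x = (\<Sum>y\<in>pverts J. real (join_dist G1 G2 x y))"
    unfolding transmission_def
    by (intro sum.cong refl graph_dist_join[OF G1 G2 reg edges assms])
  then show ?thesis
    using assms unfolding sum_pverts_join[OF G1 G2]
    by (cases x rule: join_vertex_cases)
      (auto simp: pverts_join p m vert_diag_def edge_diag_def
        pair_graph.sum_side_dist[OF G1 reg(1) m(1)] pair_graph.sum_side_dist[OF G2 reg(2) m(2)]
        simp del: side_dist.simps)
qed

text \<open>The entrywise form of \<open>D + U W\<close>: \<open>join_core\<close> gives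
  \<open>D\<close>, \<open>class_dist\<close> gives \<open>U W\<close>.\<close>

lemma laplacian_entry_join:
  assumes "x \<in> pverts J" "y \<in> pverts J"
  shows "(if x = y then transmission J x else 0) + graph_dist J x y =
         join_core G1 G2 a1 b1 a2 b2 x y + class_dist (join_class x) (join_class y)"
proof -
  interpret G1: pair_graph G1 by (rule G1)
  interpret G2: pair_graph G2 by (rule G2)
  show ?thesis
    unfolding graph_dist_join[OF G1 G2 reg edges assms] transmission_join[OF assms(1)]
    by (cases x rule: join_vertex_cases; cases y rule: join_vertex_cases)
      (auto simp: class_dist_def dest: G1.no_loops' G2.no_loops')
qed

lemma sum_join_core:
  assumes "x \<in> pverts J" "l \<in> set [0, 1, 2, 3]"
  shows "(\<Sum>y\<in>pverts J. if join_class y = l then join_core G1 G2 a1 b1 a2 b2 x y else 0) =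
         core_quotient a1 b1 r1 a2 b2 r2 (join_class x) l"
  using assms unfolding sum_pverts_join[OF G1 G2]
  by (cases x rule: join_vertex_cases)
    (auto simp: pverts_join core_quotient_def
      pair_graph.sum_side_core[OF G1 reg(1) m(1)] pair_graph.sum_side_core[OF G2 reg(2) m(2)]
      simp del: side_core.simps)

text \<open>The left side is \<open>E + W U\<close>, where \<open>W U\<close> scales
  \<open>class_dist\<close> by class sizes; the handshake identity equates edge counts with
  \<open>p * r / 2\<close>.\<close>

lemma quotient_matrix_eq_list_mat:
  "list_mat [0, 1, 2, 3] [0, 1, 2, 3] (\<lambda>k l. core_quotient a1 b1 r1 a2 b2 r2 k l +
      (\<Sum>y\<in>pverts J. if join_class y = l then class_dist k l else 0)) =
   quotient_matrix p1 r1 p2 r2" (is "?L = _")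
proof (rule eq_matI)
  fix i j
  assume "i < dim_row (quotient_matrix p1 r1 p2 r2)" "j < dim_col (quotient_matrix p1 r1 p2 r2)"
  then have "i \<in> {0, 1, 2, 3}" "j \<in> {0, 1, 2, 3}"
    by (auto simp: quotient_matrix_def mat_of_rows_list_def)
  moreover have "real p1 * real r1 = 2 * real m1" "real p2 * real r2 = 2 * real m2"
    using pair_graph.handshake[OF G1 reg(1)] pair_graph.handshake[OF G2 reg(2)] p m
    by (metis of_nat_mult of_nat_numeral)+
  ultimately show "?L $$ (i, j) = quotient_matrix p1 r1 p2 r2 $$ (i, j)"
    by (elim insertE emptyE; hypsubst)
      (simp_all add: quotient_matrix_def mat_of_rows_list_def sum_pverts_join[OF G1 G2] p m
        class_dist_def core_quotient_def vert_diag_def edge_diag_def)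
qed (auto simp: quotient_matrix_def mat_of_rows_list_def)

text \<open>The powers \<open>p1\<close> and \<open>p2\<close> remain on the left because
  \<open>m1 - p1\<close> and \<open>m2 - p2\<close> may be negative.\<close>

lemma char_poly_laplacian_join:
  assumes vs: "vertex_listing vs1 G1" "vertex_listing vs2 G2" "vertex_listing vs J"
    and L1: "char_poly (adjacency_matrix vs1 G1) = (\<Prod>l\<in>#add_mset (real r1) L1. [:- l, 1:])"
    and L2: "char_poly (adjacency_matrix vs2 G2) = (\<Prod>l\<in>#add_mset (real r2) L2. [:- l, 1:])"
  shows "char_poly (distance_signless_laplacian vs J) * ([:- b1, 1:] ^ p1 * [:- b2, 1:] ^ p2) =
     ([:- b1, 1:] ^ m1 * [:- b2, 1:] ^ m2 *
      ((\<Prod>l\<in>#L1. side_factor a1 b1 r1 l) * (\<Prod>l\<in>#L2. side_factor a2 b2 r2 l))) *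
     char_poly (quotient_matrix p1 r1 p2 r2)"
proof -
  interpret G1: pair_graph G1 by (rule G1)
  interpret G2: pair_graph G2 by (rule G2)
  have dv: "distinct vs1" "set vs1 = pverts G1" "distinct vs2" "set vs2 = pverts G2"
    "distinct vs" "set vs = pverts J"
    using vs by (auto simp: vertex_listing_def)
  obtain es1 es2 where es: "distinct es1" "set es1 = edge_set G1" "distinct es2" "set es2 = edge_set G2"
    using finite_distinct_list G1.finite_edge_set G2.finite_edge_set by metis
  have len: "length vs1 = p1" "length vs2 = p2" "length es1 = m1" "length es2 = m2"
    using dv es p m distinct_card by metis+
  let ?xs1 = "map Inl vs1 @ map Inr es1" and ?xs2 = "map Inl vs2 @ map Inr es2"
  let ?xs = "map Inl ?xs1 @ map Inr ?xs2 :: (('a + 'a set) + ('b + 'b set)) list"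
  let ?ks = "[0, 1, 2, 3 :: nat]"
  let ?c = "join_core G1 G2 a1 b1 a2 b2" and ?q = "core_quotient a1 b1 r1 a2 b2 r2"
  let ?Q = "char_poly (distance_signless_laplacian vs J)"
  let ?F1 = "side_factor a1 b1 r1" and ?F2 = "side_factor a2 b2 r2"
  have xs: "distinct ?xs" "set ?xs = pverts J"
    using dv es by (auto simp: distinct_map inj_on_def pverts_join image_Un)
  \<comment> \<open>The given listing is replaced by one sorted by class, in which the core is block
    diagonal.\<close>
  have "?Q = char_poly (list_mat ?xs ?xs (\<lambda>x y. (if x = y then transmission J x else 0) + graph_dist J x y))"
    unfolding distance_signless_laplacian_eq_list_mat[OF dv(5)]
    using dv xs by (intro char_poly_list_mat_listing) auto
  also have "list_mat ?xs ?xs (\<lambda>x y. (if x = y then transmission J x else 0) + graph_dist J x y) =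
      list_mat ?xs ?xs (\<lambda>x y. ?c x y + class_dist (join_class x) (join_class y))"
    unfolding xs(2)[symmetric]
    by (rule list_mat_cong) (rule laplacian_entry_join; simp only: xs(2))
  finally have Q: "?Q = char_poly (list_mat ?xs ?xs (\<lambda>x y. ?c x y + class_dist (join_class x) (join_class y)))" .
  have "?Q * char_poly (list_mat ?ks ?ks ?q) = char_poly (list_mat ?xs ?xs ?c) *
      char_poly (list_mat ?ks ?ks (\<lambda>k l. ?q k l + (\<Sum>y\<in>set ?xs. if join_class y = l then class_dist k l else 0)))"
    unfolding Q
  proof (rule char_poly_equitable_partition[OF xs(1)])
    fix x assume "x \<in> set ?xs"
    show "join_class x \<in> set ?ks"
      by (cases x rule: join_vertex_cases) auto
  next
    fix x l assume "x \<in> set ?xs" "l \<in> set ?ks"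
    then show "(\<Sum>y\<in>set ?xs. if join_class y = l then ?c x y else 0) = ?q (join_class x) l"
      unfolding xs(2) by (rule sum_join_core)
  qed simp
  then have 1: "?Q * (?F1 r1 * ?F2 r2) = char_poly (list_mat ?xs ?xs ?c) * char_poly (quotient_matrix p1 r1 p2 r2)"
    unfolding xs(2) quotient_matrix_eq_list_mat char_poly_core_quotient .
  have "list_mat ?xs ?xs ?c = four_block_mat (list_mat ?xs1 ?xs1 (side_core G1 a1 b1))
      (0\<^sub>m (length ?xs1) (length ?xs2)) (0\<^sub>m (length ?xs2) (length ?xs1)) (list_mat ?xs2 ?xs2 (side_core G2 a2 b2))"
    unfolding list_mat_append[of "map Inl ?xs1" "map Inr ?xs2"] list_mat_map join_core.simps
      list_mat_const_zero ..
  then have 2: "char_poly (list_mat ?xs ?xs ?c) =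
      char_poly (list_mat ?xs1 ?xs1 (side_core G1 a1 b1)) * char_poly (list_mat ?xs2 ?xs2 (side_core G2 a2 b2))"
    by (simp only: char_poly_block_upper_right_zero[OF list_mat_carrier zero_carrier_mat list_mat_carrier])
  note side1 = G1.char_poly_side_core[OF reg(1) vs(1) es(1,2) L1, of a1 b1, unfolded len]
  note side2 = G2.char_poly_side_core[OF reg(2) vs(2) es(3,4) L2, of a2 b2, unfolded len]
  \<comment> \<open>Multiplying by the factors at \<open>r1\<close> and \<open>r2\<close> lets
    \<open>1\<close> apply; they are cancelled at the end, being nonzero as a monic characteristic
    polynomial.\<close>
  have "?F1 r1 * ?F2 r2 * (?Q * ([:- b1, 1:] ^ p1 * [:- b2, 1:] ^ p2)) =
      (?Q * (?F1 r1 * ?F2 r2)) * ([:- b1, 1:] ^ p1 * [:- b2, 1:] ^ p2)"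
    by (simp only: mult_ac)
  also have "\<dots> = (char_poly (list_mat ?xs1 ?xs1 (side_core G1 a1 b1)) * [:- b1, 1:] ^ p1) *
      (char_poly (list_mat ?xs2 ?xs2 (side_core G2 a2 b2)) * [:- b2, 1:] ^ p2) *
      char_poly (quotient_matrix p1 r1 p2 r2)"
    unfolding 1 2 by (simp only: mult_ac)
  also have "\<dots> = ?F1 r1 * ?F2 r2 * (([:- b1, 1:] ^ m1 * [:- b2, 1:] ^ m2 *
      ((\<Prod>l\<in>#L1. ?F1 l) * (\<Prod>l\<in>#L2. ?F2 l))) * char_poly (quotient_matrix p1 r1 p2 r2))"
    unfolding side1 side2 image_mset_add_mset prod_mset.add_mset by (simp only: mult_ac)
  finally have "?F1 r1 * ?F2 r2 * (?Q * ([:- b1, 1:] ^ p1 * [:- b2, 1:] ^ p2)) =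
      ?F1 r1 * ?F2 r2 * (([:- b1, 1:] ^ m1 * [:- b2, 1:] ^ m2 *
      ((\<Prod>l\<in>#L1. ?F1 l) * (\<Prod>l\<in>#L2. ?F2 l))) * char_poly (quotient_matrix p1 r1 p2 r2))" .
  moreover have "?F1 r1 * ?F2 r2 \<noteq> 0"
    unfolding char_poly_core_quotient[symmetric]
    using degree_monic_char_poly[OF list_mat_carrier[of ?ks ?ks ?q]] by auto
  ultimately show ?thesis
    using mult_left_cancel by blast
qed

end

lemma plus_minus_sum_prod:
  fixes f :: "'a \<Rightarrow> real"
  shows "(\<Prod>j\<in>#M. \<Prod>x\<in>#plus_minus (f j) (g j). [:- x, 1:]) =
     (\<Prod>x\<in>#(\<Sum>j\<in>#M. plus_minus (f j) (g j)). [:- x, 1:])"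
  by (induction M) (simp_all add: plus_minus_def del: mult_pCons_left)

lemma adjacency_roots_ge:
  assumes "pair_graph G" "regular_graph G r" "vertex_listing vs G"
    and L: "char_poly (adjacency_matrix vs G) = (\<Prod>l\<in>#L. [:- l, 1:])" and "l \<in># L"
  shows "- real r \<le> l"
proof -
  obtain es where "distinct es" "set es = edge_set G"
    using finite_distinct_list pair_graph.finite_edge_set[OF assms(1)] by metis
  moreover have "poly (char_poly (adjacency_matrix vs G)) l = 0"
    using assms(5) unfolding L by (auto dest!: multi_member_split)
  ultimately show ?thesis
    using pair_graph.adjacency_eigenvalue_ge[OF assms(1-3)] by blast
qed

lemma linear_prod_replicate: "(\<Prod>x\<in>#replicate_mset n b. [:- x, 1:]) = [:- b, 1 :: real:] ^ n"
  by (induction n) (simp_all del: mult_pCons_left)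

theorem theorem3p19:
  fixes G1 :: "'a pair_pre_digraph" and G2 :: "'b pair_pre_digraph"
    and p1 p2 r1 r2 :: nat and lam1 lam2 :: "nat \<Rightarrow> real"
  assumes "pair_graph G1" and "pair_graph G2"
    and "card (pverts G1) = p1" and "card (pverts G2) = p2"
    and "regular_graph G1 r1" and "regular_graph G2 r2"
    and "vertex_listing vs1 G1" and "vertex_listing vs2 G2"
    and "spectrum_mset (adjacency_matrix vs1 G1) =
         image_mset complex_of_real (add_mset (real r1) (image_mset lam1 (mset_set {2..p1})))"
    and "spectrum_mset (adjacency_matrix vs2 G2) =
         image_mset complex_of_real (add_mset (real r2) (image_mset lam2 (mset_set {2..p2})))"
    and "Digraph_Component.connected (with_proj (subdivision_edge_join G1 G2))"
    and "vertex_listing vs (subdivision_edge_join G1 G2)"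
  shows
    "spectrum_mset (distance_signless_laplacian vs (subdivision_edge_join G1 G2))
       \<comment> \<open>for \<open>r = 1\<close> the multiplicity \<open>p * r / 2 - p\<close> is negative and means removal of copies\<close>
       + image_mset complex_of_real
           (replicate_mset (p1 - p1 * r1 div 2) (edge_value1 p1 r1 p2 r2)
          + replicate_mset (p2 - p2 * r2 div 2) (edge_value2 p1 r1 p2 r2))
     = image_mset complex_of_real
         ((\<Sum>j = 2..p1. plus_minus (center1 p1 r1 p2 r2 (lam1 j))
                                   (1/2 * sqrt (Delta1 p1 r1 p2 r2 (lam1 j))))
        + (\<Sum>j = 2..p2. plus_minus (center2 p1 r1 p2 r2 (lam2 j))
                                   (1/2 * sqrt (Delta2 p1 r1 p2 r2 (lam2 j))))
        + replicate_mset (p1 * r1 div 2 - p1) (edge_value1 p1 r1 p2 r2)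
        + replicate_mset (p2 * r2 div 2 - p2) (edge_value2 p1 r1 p2 r2))
       + spectrum_mset (quotient_matrix p1 r1 p2 r2)"
proof -
  note G1 = assms(1) and G2 = assms(2) and p = assms(3,4) and reg = assms(5,6)
    and vs = assms(7,8,12) and spec = assms(9,10) and conn = assms(11)
  define m1 m2 where "m1 = p1 * r1 div 2" and "m2 = p2 * r2 div 2"
  have m: "card (edge_set G1) = m1" "card (edge_set G2) = m2"
    using pair_graph.handshake[OF G1 reg(1)] pair_graph.handshake[OF G2 reg(2)]
    unfolding m1_def m2_def p by linarith+
  have pr: "real p1 * real r1 = 2 * real m1" "real p2 * real r2 = 2 * real m2"
    using pair_graph.handshake[OF G1 reg(1)] pair_graph.handshake[OF G2 reg(2)] p m
    by (metis of_nat_mult of_nat_numeral)+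
  define L1 L2 where "L1 = image_mset lam1 (mset_set {2..p1})" and "L2 = image_mset lam2 (mset_set {2..p2})"
  have ch1: "char_poly (adjacency_matrix vs1 G1) = (\<Prod>l\<in>#add_mset (real r1) L1. [:- l, 1:])"
    using spec(1) unfolding L1_def adjacency_matrix_eq_list_mat
    by (rule char_poly_of_spectrum_mset[OF list_mat_carrier, of vs1])
  have ch2: "char_poly (adjacency_matrix vs2 G2) = (\<Prod>l\<in>#add_mset (real r2) L2. [:- l, 1:])"
    using spec(2) unfolding L2_def adjacency_matrix_eq_list_mat
    by (rule char_poly_of_spectrum_mset[OF list_mat_carrier, of vs2])
  \<comment> \<open>An empty vertex set would make the characteristic polynomial 1, yet it must
    vanish at \<open>r\<close>.\<close>
  have ne: "pverts G \<noteq> {}" if "vertex_listing us G" "char_poly (adjacency_matrix us G) = (\<Prod>l\<in>#add_mset r L. [:- l, 1:])"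
    for us :: "'c list" and G r L
  proof
    assume "pverts G = {}"
    then have "us = []"
      using that(1) by (simp add: vertex_listing_def)
    then have "char_poly (adjacency_matrix us G) = 1"
      by (simp add: char_poly_def adjacency_matrix_def char_poly_matrix_def)
    then have "poly (\<Prod>l\<in>#add_mset r L. [:- l, 1:]) r = 1"
      using that(2) by simp
    then show False
      by simp
  qed
  \<comment> \<open>Connectedness enters here, to give the edges that the distance formula relies
    on.\<close>
  have edges: "edge_set G1 \<noteq> {}" "edge_set G2 \<noteq> {}"
    using connected_join_edges[OF conn ne[OF vs(1) ch1] ne[OF vs(2) ch2]] by auto
  let ?a1 = "vert_diag (real p1) (real r1) (real m1) (real p2) (real m2)"
  let ?a2 = "vert_diag (real p2) (real r2) (real m2) (real p1) (real m1)"
  let ?b1 = "edge_value1 p1 r1 p2 r2" and ?b2 = "edge_value2 p1 r1 p2 r2"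
  have b: "edge_diag (real p1) (real m1) (real p2) (real m2) = ?b1"
    "edge_diag (real p2) (real m2) (real p1) (real m1) = ?b2"
    by (simp_all add: edge_diag_def edge_value1_def edge_value2_def pr)
  define S1 where "S1 = (\<Sum>j = 2..p1. plus_minus (center1 p1 r1 p2 r2 (lam1 j))
                                   (1/2 * sqrt (Delta1 p1 r1 p2 r2 (lam1 j))))"
  define S2 where "S2 = (\<Sum>j = 2..p2. plus_minus (center2 p1 r1 p2 r2 (lam2 j))
                                   (1/2 * sqrt (Delta2 p1 r1 p2 r2 (lam2 j))))"
  have "(\<Prod>l\<in>#L1. side_factor ?a1 ?b1 r1 l) = (\<Prod>l\<in>#L1.
      \<Prod>x\<in>#plus_minus (center1 p1 r1 p2 r2 l) (1 / 2 * sqrt (Delta1 p1 r1 p2 r2 l)). [:- x, 1:])"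
  proof (intro arg_cong[of _ _ prod_mset] image_mset_cong side_factor_split)
    fix l assume "l \<in># L1"
    then show "- real r1 \<le> l"
      using adjacency_roots_ge[OF G1 reg(1) vs(1) ch1] by simp
    show "center1 p1 r1 p2 r2 l = (?a1 + ?b1) / 2 - l"
      by (simp add: center1_def vert_diag_def edge_value1_def pr field_simps)
    show "Delta1 p1 r1 p2 r2 l = (?a1 - 2 * l - ?b1)\<^sup>2 + 16 * (l + r1)"
    proof -
      have eq: "?a1 - 2 * l - ?b1 =
          real p1 - 4 * real r1 + real p1 * real r1 / 2 + real p2 + real p2 * real r2 / 2 - 2 * l"
        by (simp add: vert_diag_def edge_value1_def pr field_simps)
      show ?thesis
        unfolding eq by (simp add: Delta1_def power2_eq_square field_simps)
    qed
  qed
  then have F1: "(\<Prod>l\<in>#L1. side_factor ?a1 ?b1 r1 l) = (\<Prod>x\<in>#S1. [:- x, 1:])"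
    unfolding plus_minus_sum_prod by (simp add: S1_def L1_def sum_unfold_sum_mset image_mset.compositionality comp_def)
  have "(\<Prod>l\<in>#L2. side_factor ?a2 ?b2 r2 l) = (\<Prod>l\<in>#L2.
      \<Prod>x\<in>#plus_minus (center2 p1 r1 p2 r2 l) (1 / 2 * sqrt (Delta2 p1 r1 p2 r2 l)). [:- x, 1:])"
  proof (intro arg_cong[of _ _ prod_mset] image_mset_cong side_factor_split)
    fix l assume "l \<in># L2"
    then show "- real r2 \<le> l"
      using adjacency_roots_ge[OF G2 reg(2) vs(2) ch2] by simp
    show "center2 p1 r1 p2 r2 l = (?a2 + ?b2) / 2 - l"
      by (simp add: center2_def vert_diag_def edge_value2_def pr field_simps)
    show "Delta2 p1 r1 p2 r2 l = (?a2 - 2 * l - ?b2)\<^sup>2 + 16 * (l + r2)"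
    proof -
      have eq: "?a2 - 2 * l - ?b2 =
          real p2 - 4 * real r2 + real p2 * real r2 / 2 + real p1 + real p1 * real r1 / 2 - 2 * l"
        by (simp add: vert_diag_def edge_value2_def pr field_simps)
      show ?thesis
        unfolding eq by (simp add: Delta2_def power2_eq_square field_simps)
    qed
  qed
  then have F2: "(\<Prod>l\<in>#L2. side_factor ?a2 ?b2 r2 l) = (\<Prod>x\<in>#S2. [:- x, 1:])"
    unfolding plus_minus_sum_prod by (simp add: S2_def L2_def sum_unfold_sum_mset image_mset.compositionality comp_def)
  let ?Q = "distance_signless_laplacian vs (subdivision_edge_join G1 G2)"
  let ?M = "replicate_mset p1 ?b1 + replicate_mset p2 ?b2"
  let ?N = "replicate_mset m1 ?b1 + replicate_mset m2 ?b2 + (S1 + S2)"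
  have "char_poly ?Q * (\<Prod>x\<in>#?M. [:- x, 1:]) =
      (\<Prod>x\<in>#?N. [:- x, 1:]) * char_poly (quotient_matrix p1 r1 p2 r2)"
    using char_poly_laplacian_join[OF G1 G2 p reg m edges vs ch1 ch2]
    by (simp only: b F1 F2 linear_prod_replicate image_mset_union prod_mset.union)
  moreover have "?Q \<in> carrier_mat (length vs) (length vs)"
    by (simp add: distance_signless_laplacian_def distance_matrix_def)
  moreover have "quotient_matrix p1 r1 p2 r2 \<in> carrier_mat 4 4"
    by (simp add: quotient_matrix_def mat_of_rows_list_def carrier_matI)
  ultimately have main: "spectrum_mset ?Q + image_mset complex_of_real ?M =
      image_mset complex_of_real ?N + spectrum_mset (quotient_matrix p1 r1 p2 r2)"
    by (intro spectrum_mset_of_char_poly_mult)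
  \<comment> \<open>With truncated subtraction, two multiplicities \<open>i\<close> and
    \<open>j\<close> are both reduced by \<open>min i j\<close>, which treats \<open>m < p\<close>
    and \<open>m \<ge> p\<close> uniformly; the common copies form \<open>?K\<close> and are
    cancelled.\<close>
  have split: "replicate_mset i x = replicate_mset (i - j) x + replicate_mset (min i j) x"
    "replicate_mset j x = replicate_mset (j - i) x + replicate_mset (min i j) x" for i j and x :: real
    by (simp_all add: multiset_eq_iff)
  let ?K = "image_mset complex_of_real (replicate_mset (min p1 m1) ?b1 + replicate_mset (min p2 m2) ?b2)"
  have "spectrum_mset ?Q + image_mset complex_of_real
        (replicate_mset (p1 - m1) ?b1 + replicate_mset (p2 - m2) ?b2) + ?K =
      image_mset complex_of_real (S1 + S2 + replicate_mset (m1 - p1) ?b1 + replicate_mset (m2 - p2) ?b2) +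
        spectrum_mset (quotient_matrix p1 r1 p2 r2) + ?K"
    using main unfolding split(1)[of p1 ?b1 m1] split(2)[of m1 ?b1 p1] split(1)[of p2 ?b2 m2] split(2)[of m2 ?b2 p2]
    by (simp only: image_mset_union add_ac)
  then show ?thesis
    unfolding m1_def[symmetric] m2_def[symmetric] S1_def[symmetric] S2_def[symmetric]
    by (rule add_right_imp_eq)
qed

end
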